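(* For all constants $0<c_1\le1$ and $c_2\ge1$ there exists a positive constant $C^*(c_1,c_2)$, depending only on $c_1$ and $c_2$, such that the following holds for every $n\ge2$. Suppose $\theta^*\in\mathbb{R}^n$ has $k\ge1$ jumps with signs $s_1,\dots,s_k$ and let $n_0,\dots,n_k$ denote the lengths of the constant pieces of $\theta^*$; put $s_0=s_{k+1}=0$. Assume the length condition $$\min_{0\le i\le k:\,s_i\ne s_{i+1}}n_i\ge\frac{c_1n}{k+1}\quad\text{and}\quad\max_{0\le i\le k:\,s_i\ne s_{i+1}}n_i\le\frac{c_2n}{k+1}.$$ Let $\lambda^*$ be as defined in the context. Then $$\lambda^*\le C^*(c_1,c_2)\sqrt{\frac{n}{\sum_{i=0}^kI\{s_i\ne s_{i+1}\}}\log\left(\frac{en}{k+1}\right)}.$$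
   Context: For $\theta\in\mathbb{R}^n$, $D\theta := (\theta_2-\theta_1,\dots,\theta_n-\theta_{n-1})$. $\|\cdot\|$ is the Euclidean norm, $\|\cdot\|_1$ the $\ell^1$ norm. Jumps: an index $2\le j\le n$ is a jump of $\theta$ if $\theta_{j-1}\ne\theta_j$; its sign is $+1$ if $\theta_{j-1}<\theta_j$ and $-1$ otherwise. If $2\le j_1<\dots<j_k\le n$ are the jumps of $\theta^*$, then $n_0=j_1-1$, $n_i=j_{i+1}-j_i$ ($1\le i\le k-1$), $n_k=n+1-j_k$. With $f(\theta) := \|D\theta\|_1$, subdifferential $\partial f(\theta^* )$ and $\operatorname{aff}$ denoting the affine hull, let $v_0 := \operatorname{argmin}_{v\in\operatorname{aff}(\partial f(\theta^* ))}\|v\|$ (which is non-zero), $\lambda_{\theta^*}(z) := \operatorname{argmin}_{\lambda\ge0}\inf_{v\in\partial f(\theta^* )}\|z-\lambda v\|$ for $z\in\mathbb{R}^n$ (uniquely defined), and $\lambda^* := \mathbb{E}\lambda_{\theta^*}(Z)+\frac2{\|v_0\|}$ where $Z\sim N_n(0,I_n)$. The paper assumes $n\ge2r$ throughout (here $r=1$). *)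

theory Defs
  imports "HOL-Probability.Probability" "HOL-Library.Function_Algebras"
begin

text \<open>
  The dimension \<open>n\<close> must be quantified inside formulas, so \<open>\<real>\<^sup>n\<close> is the space \<open>Rn n\<close> of functions on
  \<open>nat\<close> vanishing outside the index set \<open>{1..n}\<close>; its norm is \<open>L2_set _ {1..n}\<close>.  The pointwise
  vector space structure on functions makes the library's \<open>affine hull\<close> available.
\<close>

instantiation "fun" :: (type, real_vector) real_vector
begin

definition "c *\<^sub>R f = (\<lambda>x. c *\<^sub>R f x)"

instance
  by standard (simp_all add: scaleR_fun_def fun_eq_iff plus_fun_def scaleR_add_right scaleR_add_left)

end

definition Rn :: "nat \<Rightarrow> (nat \<Rightarrow> real) set" where
  "Rn n = {x. \<forall>i. i \<notin> {1..n} \<longrightarrow> x i = 0}"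

definition inner_n :: "nat \<Rightarrow> (nat \<Rightarrow> real) \<Rightarrow> (nat \<Rightarrow> real) \<Rightarrow> real" where
  "inner_n n x y = (\<Sum>i=1..n. x i * y i)"

definition norm_n :: "nat \<Rightarrow> (nat \<Rightarrow> real) \<Rightarrow> real" where
  "norm_n n x = L2_set x {1..n}"

definition diff_op :: "(nat \<Rightarrow> real) \<Rightarrow> nat \<Rightarrow> real" where
  "diff_op \<theta> i = \<theta> (i + 1) - \<theta> i"

definition tv :: "nat \<Rightarrow> (nat \<Rightarrow> real) \<Rightarrow> real" where
  "tv n \<theta> = (\<Sum>i=1..n-1. \<bar>diff_op \<theta> i\<bar>)"

definition subdiff :: "nat \<Rightarrow> ((nat \<Rightarrow> real) \<Rightarrow> real) \<Rightarrow> (nat \<Rightarrow> real) \<Rightarrow> (nat \<Rightarrow> real) set" where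
  "subdiff n f \<theta> = {v \<in> Rn n. \<forall>\<eta> \<in> Rn n. f \<eta> \<ge> f \<theta> + inner_n n v (\<eta> - \<theta>)}"

definition v0 :: "nat \<Rightarrow> (nat \<Rightarrow> real) \<Rightarrow> (nat \<Rightarrow> real)" where
  "v0 n \<theta> = arg_min_on (norm_n n) (affine hull (subdiff n (tv n) \<theta>))"

definition lambda_fun :: "nat \<Rightarrow> (nat \<Rightarrow> real) \<Rightarrow> (nat \<Rightarrow> real) \<Rightarrow> real" where
  "lambda_fun n \<theta> z =
     arg_min_on (\<lambda>l. INF v \<in> subdiff n (tv n) \<theta>. norm_n n (z - l *\<^sub>R v)) {0..}"

text \<open>
  The standard Gaussian law on the coordinates \<open>{1..n}\<close>.  Its points are \<open>undefined\<close> rather than \<open>0\<close>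
  outside \<open>{1..n}\<close>, which \<open>lambda_fun n \<theta>\<close> does not see since \<open>norm_n n\<close> only reads \<open>{1..n}\<close>.
\<close>

definition std_gauss :: "nat \<Rightarrow> (nat \<Rightarrow> real) measure" where
  "std_gauss n = (\<Pi>\<^sub>M i\<in>{1..n}. density lborel (\<lambda>x. ennreal (std_normal_density x)))"

definition lambda_star :: "nat \<Rightarrow> (nat \<Rightarrow> real) \<Rightarrow> real" where
  "lambda_star n \<theta> = (\<integral>z. lambda_fun n \<theta> z \<partial>std_gauss n) + 2 / norm_n n (v0 n \<theta>)"

definition jumps :: "nat \<Rightarrow> (nat \<Rightarrow> real) \<Rightarrow> nat set" where
  "jumps n \<theta> = {j \<in> {2..n}. \<theta> (j - 1) \<noteq> \<theta> j}"

definition num_jumps :: "nat \<Rightarrow> (nat \<Rightarrow> real) \<Rightarrow> nat" where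
  "num_jumps n \<theta> = card (jumps n \<theta>)"

text \<open>\<open>jump n \<theta> i\<close> is \<open>j\<^sub>i\<close>, meaningful for \<open>1 \<le> i \<le> num_jumps n \<theta>\<close>.\<close>

definition jump :: "nat \<Rightarrow> (nat \<Rightarrow> real) \<Rightarrow> nat \<Rightarrow> nat" where
  "jump n \<theta> i = sorted_list_of_set (jumps n \<theta>) ! (i - 1)"

text \<open>The index \<open>i\<close> ranges over \<open>0, \<dots>, k + 1\<close>, where \<open>k\<close> is the number of jumps.\<close>

definition jump_sign :: "nat \<Rightarrow> (nat \<Rightarrow> real) \<Rightarrow> nat \<Rightarrow> int" where
  "jump_sign n \<theta> i =
     (if i = 0 \<or> i = num_jumps n \<theta> + 1 then 0
      else if \<theta> (jump n \<theta> i - 1) < \<theta> (jump n \<theta> i) then 1 else -1)"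

text \<open>Only meaningful when there is at least one jump.\<close>

definition piece_length :: "nat \<Rightarrow> (nat \<Rightarrow> real) \<Rightarrow> nat \<Rightarrow> nat" where
  "piece_length n \<theta> i =
     (if i = 0 then jump n \<theta> 1 - 1
      else if i = num_jumps n \<theta> then n + 1 - jump n \<theta> i
      else jump n \<theta> (i + 1) - jump n \<theta> i)"

definition sign_changes :: "nat \<Rightarrow> (nat \<Rightarrow> real) \<Rightarrow> nat set" where
  "sign_changes n \<theta> =
     {i \<in> {0..num_jumps n \<theta>}. jump_sign n \<theta> i \<noteq> jump_sign n \<theta> (i + 1)}"

definition length_condition :: "real \<Rightarrow> real \<Rightarrow> nat \<Rightarrow> (nat \<Rightarrow> real) \<Rightarrow> bool" where
  "length_condition c1 c2 n \<theta> \<longleftrightarrow>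
     real (Min (piece_length n \<theta> ` sign_changes n \<theta>)) \<ge> c1 * real n / (real (num_jumps n \<theta>) + 1) \<and>
     real (Max (piece_length n \<theta> ` sign_changes n \<theta>)) \<le> c2 * real n / (real (num_jumps n \<theta>) + 1)"

end

theory Submission
  imports Defs
begin

text \<open>
  Let \<open>k\<close> be the number of jumps, \<open>m\<close> the number of indices \<open>i\<close> with \<open>s\<^sub>i \<noteq> s\<^sub>i\<^sub>+\<^sub>1\<close>, \<open>X = c\<^sub>2 n / (k + 1)\<close>,
  and \<open>P\<close> the subdifferential of the total variation at \<open>\<theta>\<close>.

  An element of \<open>P\<close> has coordinates \<open>v\<^sub>j = u\<^sub>j - u\<^sub>j\<^sub>+\<^sub>1\<close> for a dual path \<open>u\<close> with values in \<open>[-1, 1]\<close>, which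
  vanishes at \<open>1\<close> and \<open>n + 1\<close> and equals \<open>s\<^sub>i\<close> at the \<open>i\<close>-th jump.  So \<open>v\<close> sums to \<open>s\<^sub>i - s\<^sub>i\<^sub>+\<^sub>1\<close> over the
  \<open>i\<close>-th piece, and this affine condition passes to the affine hull of \<open>P\<close>.  It is used twice.  By
  Cauchy-Schwarz it forces \<open>\<parallel>v\<^sub>0\<parallel>\<^sup>2 \<ge> m / X\<close>, which settles the term \<open>2 / \<parallel>v\<^sub>0\<parallel>\<close>.  And if \<open>\<lambda>\<close> minimises
  the distance from \<open>z\<close> to \<open>\<lambda> P\<close>, then comparing \<open>z\<close> with the points of \<open>\<lambda> P\<close> on the \<open>m\<close> pieces where
  the sign changes gives
  \<open>m \<lambda> \<le> (\<Sum> over these pieces of the absolute piece sum of z) + sqrt (m X) dist(z, \<lambda> P)\<close>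
  (\<open>lambda_fun_le\<close>), where by minimality \<open>dist(z, \<lambda> P)\<close> may be replaced by \<open>dist(z, l P)\<close> for any
  fixed \<open>l \<ge> 0\<close>.  The piece sums have variance at most \<open>X\<close>, so it remains to find one \<open>l\<close> with
  \<open>E dist(Z, l P)\<^sup>2 \<le> const (k + 1) ln (e X)\<close> (\<open>ray_dist_tracking\<close>).

  With \<open>l\<^sup>2\<close> of order \<open>X ln (e X)\<close> this is done by exhibiting, for every \<open>z\<close>, a path \<open>x = l u\<close> in
  \<open>[-l, l]\<close> with the prescribed values at the jumps and with decrements close to \<open>z\<close>.  Halving the
  pieces, one is left with paths that start on the boundary \<open>\<plusminus>l\<close>, must not cross it, and end at a given
  distance from it (\<open>exists_tracking_path\<close>).  Such a path follows the random walk of the partial sums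
  of \<open>z\<close>, pushed away from the boundary by a drift of slope \<open>2 M\<^sub>2\<^sub>i / i\<close> at step \<open>i\<close>, where \<open>M\<close> is the
  running maximum of the walk: between \<open>j / 2\<close> and \<open>j\<close> the drift alone accumulates \<open>M\<^sub>j\<close>.  As
  \<open>E M\<^sub>i\<^sup>2 \<le> 4 i\<close> by Doob's inequality, the squared slopes sum in expectation to a multiple of \<open>\<Sum> 1 / i\<close>,
  which is the logarithm in the result.  The far boundary is reached only on an event so unlikely
  that a straight line is affordable there.  Pieces without a sign change may be long; they are cut
  into pieces of length at most \<open>X\<close>, and since \<open>n / X \<le> k + 1\<close> this adds only a multiple of \<open>k + 1\<close>
  pieces.
\<close>

section \<open>A path that follows a walk and stays above a barrier\<close>

definition partial_sum :: "(nat \<Rightarrow> real) \<Rightarrow> nat \<Rightarrow> real" where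
  "partial_sum w j = (\<Sum>i=1..j. w i)"

definition running_max :: "(nat \<Rightarrow> real) \<Rightarrow> nat \<Rightarrow> real" where
  "running_max w j = Max ((\<lambda>i. \<bar>partial_sum w i\<bar>) ` {..j})"

text \<open>
  The index \<open>2 * i\<close> is capped at \<open>p\<close> because the walk has only \<open>p\<close> steps; the looking ahead to \<open>2 * i\<close>
  is what makes the last \<open>j / 2\<close> slopes before \<open>j\<close> all at least \<open>2 * running_max w j / j\<close>.
\<close>
definition barrier_slope :: "(nat \<Rightarrow> real) \<Rightarrow> nat \<Rightarrow> nat \<Rightarrow> real" where
  "barrier_slope w p i = 2 * running_max w (min (2 * i) p) / real i"

lemma partial_sum_0 [simp]: "partial_sum w 0 = 0"
  by (simp add: partial_sum_def)

lemma partial_sum_Suc [simp]: "partial_sum w (Suc j) = partial_sum w j + w (Suc j)"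
  by (simp add: partial_sum_def)

lemma abs_partial_sum_le_running_max: "i \<le> j \<Longrightarrow> \<bar>partial_sum w i\<bar> \<le> running_max w j"
  unfolding running_max_def by (rule Max_ge) auto

lemma running_max_leI: "(\<And>i. i \<le> j \<Longrightarrow> \<bar>partial_sum w i\<bar> \<le> c) \<Longrightarrow> running_max w j \<le> c"
  unfolding running_max_def by (subst Max_le_iff) auto

lemma running_max_nonneg [simp]: "0 \<le> running_max w j"
  using abs_partial_sum_le_running_max[of 0 j w] by simp

lemma running_max_mono: "i \<le> j \<Longrightarrow> running_max w i \<le> running_max w j"
  by (intro running_max_leI abs_partial_sum_le_running_max) simp

lemma running_max_0 [simp]: "running_max w 0 = 0"
  by (simp add: running_max_def)

lemma running_max_Suc: "running_max w (Suc j) = max (running_max w j) \<bar>partial_sum w (Suc j)\<bar>"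
  unfolding running_max_def atMost_Suc image_insert by (subst Max_insert) (auto simp: max.commute)

lemma barrier_slope_nonneg: "0 \<le> barrier_slope w p i"
  by (simp add: barrier_slope_def)

lemma running_max_le_barrier:
  assumes "j \<le> p"
  shows "running_max w j \<le> (\<Sum>i=1..j. barrier_slope w p i)"
proof (cases "j = 0")
  case False
  define I where "I = {(j + 1) div 2..j}"
  have cardI: "real (card I) \<ge> real j / 2"
    unfolding I_def by (simp; linarith)
  have "running_max w j \<le> (real j / 2) * (2 * running_max w j / real j)"
    using False by simp
  also have "\<dots> \<le> real (card I) * (2 * running_max w j / real j)"
    using cardI by (intro mult_right_mono) auto
  also have "\<dots> = (\<Sum>i\<in>I. 2 * running_max w j / real j)" by simp
  also have "\<dots> \<le> (\<Sum>i\<in>I. barrier_slope w p i)"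
  proof (intro sum_mono)
    fix i assume i: "i \<in> I"
    hence "j \<le> 2 * i" "i \<le> j" "0 < i" using False unfolding I_def by auto
    thus "2 * running_max w j / real j \<le> barrier_slope w p i"
      unfolding barrier_slope_def using assms False
      by (intro frac_le mult_left_mono running_max_mono) auto
  qed
  also have "\<dots> \<le> (\<Sum>i=1..j. barrier_slope w p i)"
    using False unfolding I_def by (intro sum_mono2) (auto simp: barrier_slope_nonneg)
  finally show ?thesis .
qed simp

lemma square_sum_le: "((a::real) + b)^2 \<le> 2 * a^2 + 2 * b^2"
  using sum_squares_ge_zero[of "a - b" 0] by (simp add: power2_eq_square algebra_simps)

lemma square_diff_le: "((a::real) - b)^2 \<le> 2 * a^2 + 2 * b^2"
  using square_sum_le[of a "-b"] by simp

text \<open>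
  The walk plus the accumulated barrier slopes is nonnegative; a final linear term moves its endpoint
  to \<open>T\<close>.  The walk itself costs nothing, so only the slopes and the linear term are paid for.
\<close>
lemma barrier_path:
  fixes w :: "nat \<Rightarrow> real"
  assumes p: "p \<ge> 1" and T: "2 * (\<Sum>i=1..p. barrier_slope w p i) \<le> T"
  shows "\<exists>y. y 0 = 0 \<and> y p = T \<and> (\<forall>i\<le>p. 0 \<le> y i \<and> y i \<le> 2 * T) \<and>
     (\<Sum>i=1..p. (w i - (y i - y (i - 1)))^2)
       \<le> 2 * (\<Sum>i=1..p. (barrier_slope w p i)^2) + 2 * T^2 / real p"
proof -
  define h where "h j = (\<Sum>i=1..j. barrier_slope w p i)" for j
  \<comment> \<open>the missing height at the endpoint, distributed linearly\<close>
  define d where "d = T - partial_sum w p - h p"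
  define y where "y j = partial_sum w j + h j + real j / real p * d" for j
  have h_mono: "h i \<le> h p" if "i \<le> p" for i
    unfolding h_def using that by (intro sum_mono2) (auto simp: barrier_slope_nonneg)
  have S_le: "\<bar>partial_sum w i\<bar> \<le> h i" if "i \<le> p" for i
    using running_max_le_barrier[OF that, of w] abs_partial_sum_le_running_max[of i i w]
    unfolding h_def by simp
  have Tp: "2 * h p \<le> T" using T unfolding h_def by simp
  have d: "0 \<le> d" "d \<le> T" using S_le[of p] Tp unfolding d_def by auto
  have "y 0 = 0" by (simp add: y_def h_def)
  moreover have "y p = T" using p by (simp add: y_def d_def)
  moreover have "0 \<le> y i \<and> y i \<le> 2 * T" if "i \<le> p" for i
  proof -
    have "real i / real p \<le> 1" using that p by simp
    hence "0 \<le> real i / real p * d" "real i / real p * d \<le> 1 * d"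
      using d by (simp, intro mult_right_mono, auto)
    thus ?thesis using S_le[OF that] h_mono[OF that] Tp d unfolding y_def by auto
  qed
  moreover have "(\<Sum>i=1..p. (w i - (y i - y (i - 1)))^2)
       \<le> 2 * (\<Sum>i=1..p. (barrier_slope w p i)^2) + 2 * T^2 / real p"
  proof -
    have "(\<Sum>i=1..p. (w i - (y i - y (i - 1)))^2) \<le> 
        (\<Sum>i=1..p. 2 * (barrier_slope w p i)^2 + 2 * (T / real p)^2)"
    proof (intro sum_mono)
      fix i assume i: "i \<in> {1..p}"
      then obtain l where l: "i = Suc l" by (cases i) auto
      have "real i / real p * d = real (i - 1) / real p * d + d / real p"
        unfolding l by (simp add: add_divide_distrib distrib_right)
      hence "w i - (y i - y (i - 1)) = - (barrier_slope w p i + d / real p)"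
        unfolding y_def h_def l by simp
      hence "(w i - (y i - y (i - 1)))^2 = (barrier_slope w p i + d / real p)^2" by (simp only: power2_minus)
      also have "\<dots> \<le> 2 * (barrier_slope w p i)^2 + 2 * (d / real p)^2" by (rule square_sum_le)
      also have "(d / real p)^2 \<le> (T / real p)^2"
        using d by (intro power_mono divide_right_mono) auto
      finally show "(w i - (y i - y (i - 1)))^2 \<le> 2 * (barrier_slope w p i)^2 + 2 * (T / real p)^2" by simp
    qed
    also have "\<dots> = 2 * (\<Sum>i=1..p. (barrier_slope w p i)^2) + 2 * T^2 / real p"
      using p by (simp add: sum.distrib sum_distrib_left[symmetric] power_divide power2_eq_square[of "real p"])
    finally show ?thesis .
  qed
  ultimately show ?thesis by blast
qed

lemma linear_path:
  fixes w :: "nat \<Rightarrow> real"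
  assumes p: "p \<ge> 1" and T: "0 \<le> T"
  shows "\<exists>y. y 0 = 0 \<and> y p = T \<and> (\<forall>i\<le>p. 0 \<le> y i \<and> y i \<le> 2 * T) \<and>
     (\<Sum>i=1..p. (w i - (y i - y (i - 1)))^2) \<le> 2 * (\<Sum>i=1..p. (w i)^2) + 2 * T^2 / real p"
proof -
  define y where "y j = real j / real p * T" for j
  have "0 \<le> y i \<and> y i \<le> 2 * T" if "i \<le> p" for i
  proof -
    have "real i / real p \<le> 1" using that p by simp
    hence "0 \<le> real i / real p * T" "real i / real p * T \<le> 1 * T"
      using T by (simp, intro mult_right_mono, auto)
    thus ?thesis using T unfolding y_def by auto
  qed
  moreover have "(\<Sum>i=1..p. (w i - (y i - y (i - 1)))^2) \<le> 2 * (\<Sum>i=1..p. (w i)^2) + 2 * T^2 / real p"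
  proof -
    have "(\<Sum>i=1..p. (w i - (y i - y (i - 1)))^2) \<le> (\<Sum>i=1..p. 2 * (w i)^2 + 2 * (T / real p)^2)"
    proof (intro sum_mono)
      fix i assume i: "i \<in> {1..p}"
      then obtain l where l: "i = Suc l" by (cases i) auto
      have "y i - y (i - 1) = T / real p" unfolding l y_def by (simp add: add_divide_distrib distrib_right)
      thus "(w i - (y i - y (i - 1)))^2 \<le> 2 * (w i)^2 + 2 * (T / real p)^2"
        using square_diff_le by metis
    qed
    also have "\<dots> = 2 * (\<Sum>i=1..p. (w i)^2) + 2 * T^2 / real p"
      using p by (simp add: sum.distrib sum_distrib_left[symmetric] power_divide power2_eq_square[of "real p"])
    finally show ?thesis .
  qed
  ultimately show ?thesis using p by (intro exI[of _ y]) (auto simp: y_def)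
qed

lemma sum_inverse_sqrt_le: "(\<Sum>i=1..p. 1 / sqrt (real i)) \<le> 2 * sqrt (real p)"
proof (induction p)
  case (Suc p)
  define a where "a = sqrt (real p)"
  define b where "b = sqrt (real (Suc p))"
  have b: "b > 0" "a \<ge> 0" "b^2 = a^2 + 1" "a \<le> b" unfolding a_def b_def by auto
  have "1 = (b - a) * (b + a)" using b by (simp add: power2_eq_square algebra_simps)
  also have "\<dots> \<le> (b - a) * (2 * b)" using b by (intro mult_left_mono) auto
  finally have "1 / b \<le> 2 * b - 2 * a" using b by (simp add: field_simps)
  thus ?case using Suc unfolding a_def b_def by simp
qed simp

text \<open>
  If the walk grows like a square root, the slopes decay like \<open>1 / sqrt i\<close> and so also sum to a square
  root.  This is what keeps the tracking path below twice its final height.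
\<close>
lemma barrier_le_of_sqrt_growth:
  assumes \<kappa>: "0 \<le> \<kappa>" and S: "\<And>j. j \<in> {1..p} \<Longrightarrow> \<bar>partial_sum w j\<bar> \<le> \<kappa> * sqrt (real j)"
  shows "(\<Sum>i=1..p. barrier_slope w p i) \<le> 6 * \<kappa> * sqrt (real p)"
proof -
  have "barrier_slope w p i \<le> 3 * \<kappa> * (1 / sqrt (real i))" if i: "i \<in> {1..p}" for i
  proof -
    have "running_max w (min (2 * i) p) \<le> \<kappa> * sqrt (real (2 * i))"
    proof (rule running_max_leI)
      fix j assume j: "j \<le> min (2 * i) p"
      show "\<bar>partial_sum w j\<bar> \<le> \<kappa> * sqrt (real (2 * i))"
      proof (cases "j = 0")
        case False
        hence "\<bar>partial_sum w j\<bar> \<le> \<kappa> * sqrt (real j)" using S[of j] j by auto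
        also have "\<dots> \<le> \<kappa> * sqrt (real (2 * i))" using j \<kappa> by (intro mult_left_mono) auto
        finally show ?thesis .
      qed (use \<kappa> in simp)
    qed
    also have "\<dots> \<le> \<kappa> * ((3/2) * sqrt (real i))"
    proof -
      have "sqrt 2 \<le> 3/2" by (rule real_le_lsqrt) (auto simp: power2_eq_square)
      hence "sqrt 2 * sqrt (real i) \<le> (3/2) * sqrt (real i)" by (intro mult_right_mono) auto
      thus ?thesis using \<kappa> by (intro mult_left_mono) (auto simp: real_sqrt_mult)
    qed
    finally have "barrier_slope w p i \<le> 2 * (\<kappa> * ((3/2) * sqrt (real i))) / real i"
      unfolding barrier_slope_def by (intro divide_right_mono mult_left_mono) auto
    also have "\<dots> = 3 * \<kappa> * (sqrt (real i) / real i)" by simp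
    also have "sqrt (real i) / real i = 1 / sqrt (real i)"
      using i by (simp add: field_simps)
    finally show ?thesis .
  qed
  hence "(\<Sum>i=1..p. barrier_slope w p i) \<le> (\<Sum>i=1..p. 3 * \<kappa> * (1 / sqrt (real i)))"
    by (rule sum_mono)
  also have "\<dots> = 3 * \<kappa> * (\<Sum>i=1..p. 1 / sqrt (real i))" by (simp add: sum_distrib_left)
  also have "\<dots> \<le> 3 * \<kappa> * (2 * sqrt (real p))"
    using \<kappa> by (intro mult_left_mono sum_inverse_sqrt_le) auto
  finally show ?thesis by simp
qed

text \<open>
  Doob's \<open>L\<^sup>2\<close> maximal inequality in pathwise form: the sum on the left is a martingale transform of the
  walk, so its expectation vanishes and only \<open>E M\<^sup>2 \<le> 4 E S\<^sup>2\<close> remains.  It follows from summation by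
  parts, since the running maximum increases only when it equals the current absolute value.
\<close>
lemma pathwise_doob:
  "(running_max w p)^2 + 4 * (\<Sum>j<p. running_max w j * sgn (partial_sum w j) * w (Suc j))
     \<le> 4 * (partial_sum w p)^2"
proof -
  let ?M = "running_max w" and ?X = "\<lambda>j. \<bar>partial_sum w j\<bar>"
  have step: "sgn (partial_sum w j) * w (Suc j) \<le> ?X (Suc j) - ?X j" for j
    by (auto simp: sgn_if abs_if)
  have "(\<Sum>j<p. ?M j * (?X (Suc j) - ?X j)) + (?M p)^2 / 2 \<le> ?M p * ?X p"
  proof (induction p)
    case (Suc p)
    define a b x y where "a = ?M p" and "b = ?M (Suc p)" and "x = ?X p" and "y = ?X (Suc p)"
    have "b = a \<or> b = y" unfolding a_def b_def y_def running_max_Suc by (auto simp: max_def)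
    moreover have "0 \<le> (b - a)^2" by simp
    ultimately have "a * (y - x) + b^2 / 2 - a^2 / 2 \<le> b * y - a * x"
      by (auto simp: power2_eq_square algebra_simps)
    hence "?M p * (?X (Suc p) - ?X p) + (?M (Suc p))^2 / 2 - (?M p)^2 / 2 
        \<le> ?M (Suc p) * ?X (Suc p) - ?M p * ?X p"
      unfolding a_def b_def x_def y_def .
    thus ?case using Suc by simp
  qed simp
  moreover have "?M p * ?X p \<le> (?M p)^2 / 4 + (?X p)^2"
    using zero_le_power2[of "?M p / 2 - ?X p"] by (simp add: power2_eq_square algebra_simps)
  moreover have "(\<Sum>j<p. ?M j * sgn (partial_sum w j) * w (Suc j))
      \<le> (\<Sum>j<p. ?M j * (?X (Suc j) - ?X j))"
    using step by (intro sum_mono) (auto simp: mult.assoc intro!: mult_left_mono)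
  ultimately show ?thesis by simp
qed

section \<open>The standard Gaussian law on coordinates\<close>

lemma prob_space_std_gauss: "prob_space (std_gauss n)"
  unfolding std_gauss_def by (intro prob_space_PiM prob_space_normal_density) simp

lemma measurable_coord [measurable]: "i \<in> {1..n} \<Longrightarrow> (\<lambda>z. z i) \<in> borel_measurable (std_gauss n)"
  unfolding std_gauss_def by measurable

lemma product_sigma_finite_std_normal: "product_sigma_finite (\<lambda>i::nat. std_normal_distribution)"
  by (intro product_sigma_finite.intro prob_space_imp_sigma_finite prob_space_normal_density) simp

lemma std_gauss_coord:
  fixes f :: "real \<Rightarrow> real"
  assumes i: "i \<in> {1..n}" and f: "integrable std_normal_distribution f"
  shows "integrable (std_gauss n) (\<lambda>z. f (z i))"
    and "(\<integral>z. f (z i) \<partial>std_gauss n) = (\<integral>x. f x \<partial>std_normal_distribution)"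
proof -
  have d: "distr (std_gauss n) std_normal_distribution (\<lambda>z. z i) = std_normal_distribution"
    unfolding std_gauss_def using i
    by (intro distr_PiM_component prob_space_normal_density) simp_all
  have m: "(\<lambda>z. z i) \<in> measurable (std_gauss n) std_normal_distribution"
    using i by simp
  have fm: "f \<in> borel_measurable std_normal_distribution" using f by (rule borel_measurable_integrable)
  show "integrable (std_gauss n) (\<lambda>z. f (z i))"
    using f fm by (subst integrable_distr_eq[OF m, symmetric]) (simp_all only: d)
  show "(\<integral>z. f (z i) \<partial>std_gauss n) = (\<integral>x. f x \<partial>std_normal_distribution)"
    using fm by (subst integral_distr[OF m, symmetric]) (simp_all only: d)
qed

lemma std_gauss_square:
  assumes "i \<in> {1..n}"
  shows "integrable (std_gauss n) (\<lambda>z. (z i)^2)" and "(\<integral>z. (z i)^2 \<partial>std_gauss n) = 1"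
  using std_gauss_coord[OF assms, of "\<lambda>x. x^2"] std_normal_distribution_even_moments[of 1]
  by (simp_all add: integrable_std_normal_distribution_moment)

lemma std_gauss_fourth:
  assumes "i \<in> {1..n}"
  shows "integrable (std_gauss n) (\<lambda>z. (z i)^4)" and "(\<integral>z. (z i)^4 \<partial>std_gauss n) = 3"
  using std_gauss_coord[OF assms, of "\<lambda>x. x^4"] std_normal_distribution_even_moments[of 2]
  by (simp_all add: integrable_std_normal_distribution_moment fact_numeral)

lemma std_normal_mgf:
  "integrable std_normal_distribution (\<lambda>x. exp (c * x))"
  "(\<integral>x. exp (c * x) \<partial>std_normal_distribution) = exp (c^2 / 2)"
proof -
  have eq: "std_normal_density x * exp (c * x) = exp (c^2 / 2) * normal_density c 1 x" for x
    by (simp add: normal_density_def exp_add[symmetric] power2_eq_square field_simps)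
  show "integrable std_normal_distribution (\<lambda>x. exp (c * x))"
    by (subst integrable_density) (auto simp: eq normal_density_nonneg)
  show "(\<integral>x. exp (c * x) \<partial>std_normal_distribution) = exp (c^2 / 2)"
    by (subst integral_density) (auto simp: eq normal_density_nonneg)
qed

lemma std_gauss_mgf:
  fixes c :: "nat \<Rightarrow> real"
  shows "integrable (std_gauss n) (\<lambda>z. exp (\<Sum>i=1..n. c i * z i))"
    and "(\<integral>z. exp (\<Sum>i=1..n. c i * z i) \<partial>std_gauss n) = exp ((\<Sum>i=1..n. (c i)^2) / 2)"
proof -
  interpret product_sigma_finite "\<lambda>i::nat. std_normal_distribution"
    by (rule product_sigma_finite_std_normal)
  show "integrable (std_gauss n) (\<lambda>z. exp (\<Sum>i=1..n. c i * z i))"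
    unfolding std_gauss_def exp_sum[OF finite_atLeastAtMost]
    by (rule product_integrable_prod) (simp_all add: std_normal_mgf)
  show "(\<integral>z. exp (\<Sum>i=1..n. c i * z i) \<partial>std_gauss n) = exp ((\<Sum>i=1..n. (c i)^2) / 2)"
    unfolding std_gauss_def exp_sum[OF finite_atLeastAtMost] sum_divide_distrib
    by (subst product_integral_prod) (simp_all add: std_normal_mgf)
qed

text \<open>
  Independence in the form that makes martingale transforms centred; integrating out coordinate \<open>i\<close>
  first gives \<open>0\<close>.
\<close>
lemma std_gauss_orthogonal:
  assumes i: "i \<in> {1..n}" and f: "\<And>z c. f (z(i := c)) = f z"
    and int: "integrable (std_gauss n) (\<lambda>z. f z * z i)"
  shows "(\<integral>z. f z * z i \<partial>std_gauss n) = 0"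
proof -
  interpret product_sigma_finite "\<lambda>i::nat. std_normal_distribution"
    by (rule product_sigma_finite_std_normal)
  have I: "{1..n} = insert i ({1..n} - {i})" using i by auto
  have int': "integrable (Pi\<^sub>M (insert i ({1..n} - {i})) (\<lambda>i. std_normal_distribution)) (\<lambda>z. f z * z i)"
    using int unfolding std_gauss_def by (simp only: I[symmetric])
  have "(\<integral>x. x \<partial>std_normal_distribution) = 0"
    using integral_std_normal_distribution_moment_odd[of 1] by simp
  moreover have "(\<integral>z. f z * z i \<partial>std_gauss n) = 
      (\<integral>x. (\<integral>y. f (x(i:=y)) * (x(i:=y)) i \<partial>std_normal_distribution) 
         \<partial>Pi\<^sub>M ({1..n} - {i}) (\<lambda>i. std_normal_distribution))"
    unfolding std_gauss_def
    using int' by (subst I, intro product_integral_insert) auto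
  ultimately show ?thesis by (simp add: f)
qed

section \<open>Random walks read off distinct coordinates\<close>

lemma integrable_product_of_squares:
  fixes f g :: "(nat \<Rightarrow> real) \<Rightarrow> real"
  assumes "f \<in> borel_measurable M" "g \<in> borel_measurable M"
    "integrable M (\<lambda>z. (f z)^2)" "integrable M (\<lambda>z. (g z)^2)"
  shows "integrable M (\<lambda>z. f z * g z)"
proof (rule Bochner_Integration.integrable_bound[OF Bochner_Integration.integrable_add[OF assms(3,4)]])
  have "\<bar>f z * g z\<bar> \<le> (f z)^2 + (g z)^2" for z
  proof -
    have "2 * (\<bar>f z\<bar> * \<bar>g z\<bar>) \<le> (f z)^2 + (g z)^2"
      using zero_le_power2[of "\<bar>f z\<bar> - \<bar>g z\<bar>"] by (simp add: power2_diff mult.assoc)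
    moreover have "0 \<le> \<bar>f z\<bar> * \<bar>g z\<bar>" by simp
    ultimately show ?thesis unfolding abs_mult by linarith
  qed
  thus "AE z in M. norm (f z * g z) \<le> norm ((f z)^2 + (g z)^2)" by (auto intro!: AE_I2)
qed (use assms in measurable)

text \<open>
  The tracking paths read a piece from its left or its right end and touch the boundary \<open>l\<close> or \<open>-l\<close>.
  The enumeration \<open>\<sigma>\<close> and the sign \<open>\<epsilon>\<close> cover all four cases at once.
\<close>
locale coordinate_walk =
  fixes n p :: nat and \<sigma> :: "nat \<Rightarrow> nat" and \<epsilon> :: real
  assumes inj: "inj_on \<sigma> {1..p}" and range: "\<sigma> ` {1..p} \<subseteq> {1..n}" and sign: "\<epsilon>^2 = 1"
begin

abbreviation walk :: "(nat \<Rightarrow> real) \<Rightarrow> nat \<Rightarrow> real" where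
  "walk z \<equiv> (\<lambda>i. \<epsilon> * z (\<sigma> i))"

lemma in_range: "i \<in> {1..p} \<Longrightarrow> \<sigma> i \<in> {1..n}"
  using range by blast

lemma walk_measurable: "i \<in> {1..p} \<Longrightarrow> (\<lambda>z. walk z i) \<in> borel_measurable (std_gauss n)"
  using in_range[of i] by (intro borel_measurable_times measurable_coord) auto

lemma partial_sum_measurable: "j \<le> p \<Longrightarrow> (\<lambda>z. partial_sum (walk z) j) \<in> borel_measurable (std_gauss n)"
  unfolding partial_sum_def by (intro borel_measurable_sum walk_measurable) auto

lemma running_max_measurable: "j \<le> p \<Longrightarrow> (\<lambda>z. running_max (walk z) j) \<in> borel_measurable (std_gauss n)"
proof (induction j)
  case (Suc j)
  have "(\<lambda>z. running_max (walk z) j) \<in> borel_measurable (std_gauss n)"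
    using Suc by simp
  thus ?case unfolding running_max_Suc using partial_sum_measurable[OF Suc.prems]
    by (intro borel_measurable_max borel_measurable_abs)
qed simp

lemma walk_square:
  assumes "i \<in> {1..p}"
  shows "(walk z i)^2 = (z (\<sigma> i))^2" "integrable (std_gauss n) (\<lambda>z. (walk z i)^2)"
    "(\<integral>z. (walk z i)^2 \<partial>std_gauss n) = 1"
  using std_gauss_square[OF in_range[OF assms]] sign by (simp_all add: power_mult_distrib)

text \<open>
  The walk up to time \<open>j\<close> ignores the coordinate of any later step, as \<open>std_gauss_orthogonal\<close> requires.
\<close>
lemma partial_sum_update:
  "j < i \<Longrightarrow> i \<le> p \<Longrightarrow> l \<le> j \<Longrightarrow> partial_sum (walk (z(\<sigma> i := c))) l = partial_sum (walk z) l"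
proof -
  assume *: "j < i" "i \<le> p" "l \<le> j"
  have "\<sigma> a \<noteq> \<sigma> i" if "a \<in> {1..l}" for a
    using that * inj_onD[OF inj, of a i] by fastforce
  thus ?thesis unfolding partial_sum_def by (intro sum.cong) simp_all
qed

lemma running_max_update:
  assumes "j < i" "i \<le> p"
  shows "running_max (walk (z(\<sigma> i := c))) j = running_max (walk z) j"
proof -
  have "\<bar>partial_sum (walk (z(\<sigma> i := c))) l\<bar> = \<bar>partial_sum (walk z) l\<bar>" if "l \<in> {..j}" for l
    using partial_sum_update[OF assms, of l z c] that by (simp only: atMost_iff)
  hence "(\<lambda>l. \<bar>partial_sum (walk (z(\<sigma> i := c))) l\<bar>) ` {..j} = (\<lambda>l. \<bar>partial_sum (walk z) l\<bar>) ` {..j}"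
    by (rule image_cong[OF refl])
  thus ?thesis unfolding running_max_def by (simp only:)
qed

lemma abs_partial_sum_le: "j \<le> p \<Longrightarrow> \<bar>partial_sum (walk z) j\<bar>^2 \<le> real p * (\<Sum>i=1..p. (walk z i)^2)"
proof -
  assume j: "j \<le> p"
  have "\<bar>partial_sum (walk z) j\<bar>^2 = (\<Sum>i=1..j. 1 * walk z i)^2"
    by (simp add: partial_sum_def)
  also have "\<dots> \<le> (\<Sum>i=1..j. 1^2) * (\<Sum>i=1..j. (walk z i)^2)" by (rule Cauchy_Schwarz_ineq_sum)
  also have "\<dots> \<le> real p * (\<Sum>i=1..p. (walk z i)^2)"
    using j by (intro mult_mono sum_mono2 sum_nonneg) auto
  finally show ?thesis .
qed

lemma running_max_square_le: "j \<le> p \<Longrightarrow> (running_max (walk z) j)^2 \<le> real p * (\<Sum>i=1..p. (walk z i)^2)"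
proof -
  assume j: "j \<le> p"
  have nn: "0 \<le> real p * (\<Sum>i=1..p. (walk z i)^2)" by (intro mult_nonneg_nonneg sum_nonneg) auto
  have "running_max (walk z) j \<le> sqrt (real p * (\<Sum>i=1..p. (walk z i)^2))"
    using j abs_partial_sum_le by (intro running_max_leI real_le_rsqrt) auto
  hence "(running_max (walk z) j)^2 \<le> (sqrt (real p * (\<Sum>i=1..p. (walk z i)^2)))^2"
    by (intro power_mono running_max_nonneg)
  thus ?thesis using nn by (simp only: real_sqrt_pow2)
qed

lemma integrable_sum_squares: "integrable (std_gauss n) (\<lambda>z. real p * (\<Sum>i=1..p. (walk z i)^2))"
  by (rule integrable_mult_right, rule Bochner_Integration.integrable_sum, rule walk_square(2))

lemma integrable_running_max: 
  assumes j: "j \<le> p" 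
  shows "integrable (std_gauss n) (\<lambda>z. (running_max (walk z) j)^2)"
proof (rule Bochner_Integration.integrable_bound[OF integrable_sum_squares])
  show "(\<lambda>z. (running_max (walk z) j)^2) \<in> borel_measurable (std_gauss n)"
    by (intro borel_measurable_power running_max_measurable j)
  have "norm ((running_max (walk z) j)^2) \<le> norm (real p * (\<Sum>i=1..p. (walk z i)^2))" for z
    using running_max_square_le[OF j, of z] zero_le_power2[of "running_max (walk z) j"]
    unfolding real_norm_def by linarith
  thus "AE z in std_gauss n. norm ((running_max (walk z) j)^2) \<le> norm (real p * (\<Sum>i=1..p. (walk z i)^2))"
    by simp
qed

lemma integrable_partial_sum: 
  assumes j: "j \<le> p" 
  shows "integrable (std_gauss n) (\<lambda>z. (partial_sum (walk z) j)^2)"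
proof (rule Bochner_Integration.integrable_bound[OF integrable_running_max[OF j]])
  show "(\<lambda>z. (partial_sum (walk z) j)^2) \<in> borel_measurable (std_gauss n)"
    by (intro borel_measurable_power partial_sum_measurable j)
  have "norm ((partial_sum (walk z) j)^2) \<le> norm ((running_max (walk z) j)^2)" for z
    using power_mono[OF abs_partial_sum_le_running_max[OF order_refl, of "walk z" j], of 2] by simp
  thus "AE z in std_gauss n. norm ((partial_sum (walk z) j)^2) \<le> norm ((running_max (walk z) j)^2)"
    by simp
qed

lemma partial_sum_square: "j \<le> p \<Longrightarrow> (\<integral>z. (partial_sum (walk z) j)^2 \<partial>std_gauss n) = real j"
proof (induction j)
  case (Suc j)
  let ?S = "\<lambda>z. partial_sum (walk z) j"
  have i: "Suc j \<in> {1..p}" using Suc by auto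
  have cross: "integrable (std_gauss n) (\<lambda>z. (2 * \<epsilon> * ?S z) * z (\<sigma> (Suc j)))"
    using integrable_product_of_squares[of ?S "std_gauss n" "\<lambda>z. z (\<sigma> (Suc j))"] Suc.prems
      in_range[OF i] partial_sum_measurable[of j] integrable_partial_sum[of j]
      std_gauss_square(1)[OF in_range[OF i]]
      integrable_mult_right[of "2 * \<epsilon>" "std_gauss n" "\<lambda>z. ?S z * z (\<sigma> (Suc j))"]
    by (simp add: mult.assoc)
  have "(\<integral>z. (2 * \<epsilon> * ?S z) * z (\<sigma> (Suc j)) \<partial>std_gauss n) = 0"
    using Suc.prems by (intro std_gauss_orthogonal in_range[OF i] cross)
      (auto simp: partial_sum_update[of j] simp del: fun_upd_apply)
  moreover have "(partial_sum (walk z) (Suc j))^2 = 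
     (?S z)^2 + (2 * \<epsilon> * ?S z) * z (\<sigma> (Suc j)) + (walk z (Suc j))^2" for z
    by (simp add: power2_eq_square algebra_simps)
  ultimately show ?case using Suc cross walk_square(2,3)[OF i] integrable_partial_sum[of j]
    by simp
qed simp

lemma running_max_square: "j \<le> p \<Longrightarrow> (\<integral>z. (running_max (walk z) j)^2 \<partial>std_gauss n) \<le> 4 * real j"
proof -
  assume j: "j \<le> p"
  let ?f = "\<lambda>l z. \<epsilon> * (running_max (walk z) l * sgn (partial_sum (walk z) l))"
  let ?g = "\<lambda>l z. running_max (walk z) l * sgn (partial_sum (walk z) l) * walk z (Suc l)"
  have g: "?g l z = ?f l z * z (\<sigma> (Suc l))" for l z by simp
  have sgn_meas: "(sgn :: real \<Rightarrow> real) \<in> borel_measurable borel" by simp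
  have int: "integrable (std_gauss n) (?g l)" and zero: "(\<integral>z. ?g l z \<partial>std_gauss n) = 0" if "l < j" for l
  proof -
    have i: "Suc l \<in> {1..p}" using that j by auto
    have l: "l \<le> p" using i by auto
    show *: "integrable (std_gauss n) (?g l)"
    proof (rule integrable_product_of_squares[OF _ walk_measurable[OF i] _ walk_square(2)[OF i]])
      show m: "(\<lambda>z. running_max (walk z) l * sgn (partial_sum (walk z) l)) \<in> borel_measurable (std_gauss n)"
        using running_max_measurable[OF l] measurable_compose[OF partial_sum_measurable[OF l] sgn_meas]
        by (intro borel_measurable_times)
      show "integrable (std_gauss n) (\<lambda>z. (running_max (walk z) l * sgn (partial_sum (walk z) l))^2)"
      proof (rule Bochner_Integration.integrable_bound[OF integrable_running_max[OF l]])
        show "(\<lambda>z. (running_max (walk z) l * sgn (partial_sum (walk z) l))^2) \<in> borel_measurable (std_gauss n)"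
          by (rule borel_measurable_power[OF m])
      qed (simp add: power_mult_distrib sgn_if)
    qed
    show "(\<integral>z. ?g l z \<partial>std_gauss n) = 0"
      unfolding g using i *
      by (intro std_gauss_orthogonal in_range)
        (auto simp: g partial_sum_update[of l] running_max_update simp del: fun_upd_apply)
  qed
  have int_sum: "integrable (std_gauss n) (\<lambda>z. \<Sum>l<j. ?g l z)" using int by (intro Bochner_Integration.integrable_sum) auto
  have "(\<integral>z. (running_max (walk z) j)^2 \<partial>std_gauss n) = 
     (\<integral>z. (running_max (walk z) j)^2 + 4 * (\<Sum>l<j. ?g l z) \<partial>std_gauss n)"
    using int_sum int zero integrable_running_max[OF j] by (simp add: Bochner_Integration.integral_sum)
  also have "\<dots> \<le> (\<integral>z. 4 * (partial_sum (walk z) j)^2 \<partial>std_gauss n)"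
    by (intro integral_mono Bochner_Integration.integrable_add integrable_mult_right
        integrable_running_max integrable_partial_sum j int_sum pathwise_doob)
  also have "\<dots> = 4 * real j" using partial_sum_square[OF j] by simp
  finally show ?thesis .
qed

lemma partial_sum_mgf:
  assumes j: "j \<le> p"
  shows "integrable (std_gauss n) (\<lambda>z. exp (c * partial_sum (walk z) j))"
    and "(\<integral>z. exp (c * partial_sum (walk z) j) \<partial>std_gauss n) = exp (c^2 * real j / 2)"
proof -
  define a where "a i = (if i \<in> \<sigma> ` {1..j} then c * \<epsilon> else 0)" for i
  have inj_j: "inj_on \<sigma> {1..j}" using inj j by (auto intro: inj_on_subset)
  have sub: "\<sigma> ` {1..j} \<subseteq> {1..n}" using range j by auto
  have "c * partial_sum (walk z) j = (\<Sum>i\<in>\<sigma> ` {1..j}. c * \<epsilon> * z i)" for z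
    unfolding partial_sum_def sum.reindex[OF inj_j] o_def sum_distrib_left by (simp only: mult.assoc)
  also have "(\<Sum>i\<in>\<sigma> ` {1..j}. c * \<epsilon> * z i) = (\<Sum>i=1..n. a i * z i)" for z
    using sub by (intro sum.mono_neutral_cong_left) (auto simp: a_def)
  finally have eq: "c * partial_sum (walk z) j = (\<Sum>i=1..n. a i * z i)" for z .
  have "(\<Sum>i=1..n. (a i)^2) = (\<Sum>i\<in>\<sigma> ` {1..j}. c^2)"
    using sub sign by (intro sum.mono_neutral_cong_right) (auto simp: a_def power_mult_distrib)
  also have "\<dots> = c^2 * real j" using card_image[OF inj_j] by simp
  finally have sq: "(\<Sum>i=1..n. (a i)^2) = c^2 * real j" .
  show "integrable (std_gauss n) (\<lambda>z. exp (c * partial_sum (walk z) j))"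
    unfolding eq by (rule std_gauss_mgf)
  show "(\<integral>z. exp (c * partial_sum (walk z) j) \<partial>std_gauss n) = exp (c^2 * real j / 2)"
    unfolding eq std_gauss_mgf sq ..
qed

end

section \<open>Existence of tracking paths\<close>

lemma harmonic_sum_le: "p \<ge> 1 \<Longrightarrow> (\<Sum>i=1..p. 1 / real i) \<le> 1 + ln (real p)"
proof (induction p rule: nat_induct_at_least)
  case (Suc p)
  have "ln (real p / real (Suc p)) \<le> real p / real (Suc p) - 1"
    using Suc.hyps by (intro ln_le_minus_one) auto
  also have "\<dots> = - 1 / real (Suc p)" by (simp add: field_simps)
  finally have "1 / real (Suc p) \<le> ln (real (Suc p)) - ln (real p)"
    using Suc.hyps by (simp add: ln_div)
  thus ?case using Suc.IH by simp
qed simp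

context coordinate_walk begin

lemma barrier_square:
  assumes i: "i \<in> {1..p}"
  shows "integrable (std_gauss n) (\<lambda>z. (barrier_slope (walk z) p i)^2)"
    and "(\<integral>z. (barrier_slope (walk z) p i)^2 \<partial>std_gauss n) \<le> 32 * (1 / real i)"
proof -
  let ?m = "min (2 * i) p"
  have eq: "(barrier_slope (walk z) p i)^2 = 4 / (real i)^2 * (running_max (walk z) ?m)^2" for z
    by (simp add: barrier_slope_def power_mult_distrib power_divide)
  have m: "?m \<le> p" by simp
  show "integrable (std_gauss n) (\<lambda>z. (barrier_slope (walk z) p i)^2)"
    unfolding eq by (rule integrable_mult_right[OF integrable_running_max[OF m]])
  have "(\<integral>z. (barrier_slope (walk z) p i)^2 \<partial>std_gauss n) \<le> 4 / (real i)^2 * (4 * real ?m)"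
    unfolding eq integral_mult_right_zero by (rule mult_left_mono[OF running_max_square[OF m]]) simp
  also have "\<dots> \<le> 4 / (real i)^2 * (4 * (2 * real i))" by (intro mult_left_mono) auto
  also have "\<dots> = 32 * (1 / real i)" using i by (simp add: power2_eq_square field_simps)
  finally show "(\<integral>z. (barrier_slope (walk z) p i)^2 \<partial>std_gauss n) \<le> 32 * (1 / real i)" .
qed

lemma walk_fourth:
  assumes "i \<in> {1..p}"
  shows "integrable (std_gauss n) (\<lambda>z. (walk z i)^4)" "(\<integral>z. (walk z i)^4 \<partial>std_gauss n) = 3"
proof -
  have e: "\<epsilon>^4 = 1" using sign power_mult[of \<epsilon> 2 2] by simp
  have "(walk z i)^4 = (z (\<sigma> i))^4" for z by (simp only: power_mult_distrib e mult_1)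
  thus "integrable (std_gauss n) (\<lambda>z. (walk z i)^4)" "(\<integral>z. (walk z i)^4 \<partial>std_gauss n) = 3"
    using std_gauss_fourth[OF in_range[OF assms]] by simp_all
qed

text \<open>
  A smooth upper bound for the indicator of the event that step \<open>j\<close> exceeds \<open>\<kappa>\<close> standard deviations,
  in the manner of Chernoff; its expectation is given by the moment generating function.
\<close>
definition tail_weight :: "real \<Rightarrow> nat \<Rightarrow> (nat \<Rightarrow> real) \<Rightarrow> real" where
  "tail_weight \<kappa> j z = exp (- (\<kappa>^2)) * 
     (exp (\<kappa> / sqrt (real j) * partial_sum (walk z) j) + exp (- \<kappa> / sqrt (real j) * partial_sum (walk z) j))"

lemma tail_weight_nonneg: "0 \<le> tail_weight \<kappa> j z"
  by (simp add: tail_weight_def)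

lemma tail_weight_integral:
  assumes j: "j \<in> {1..p}"
  shows "integrable (std_gauss n) (tail_weight \<kappa> j)"
    and "(\<integral>z. tail_weight \<kappa> j z \<partial>std_gauss n) = 2 * exp (- (\<kappa>^2) / 2)"
proof -
  have jp: "j \<le> p" using j by simp
  have c: "(\<kappa> / sqrt (real j))^2 * real j / 2 = \<kappa>^2 / 2" "(- \<kappa> / sqrt (real j))^2 * real j / 2 = \<kappa>^2 / 2"
    using j by (simp_all add: power_divide)
  note i = partial_sum_mgf[OF jp]
  show "integrable (std_gauss n) (tail_weight \<kappa> j)"
    unfolding tail_weight_def by (intro integrable_mult_right Bochner_Integration.integrable_add i)
  have "(\<integral>z. tail_weight \<kappa> j z \<partial>std_gauss n) = exp (- (\<kappa>^2)) * (exp (\<kappa>^2 / 2) + exp (\<kappa>^2 / 2))"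
    unfolding tail_weight_def integral_mult_right_zero
    by (subst Bochner_Integration.integral_add[OF i(1) i(1)]) (simp only: i(2) c)
  also have "\<dots> = 2 * exp (- (\<kappa>^2) + \<kappa>^2 / 2)" unfolding exp_add by (simp only: mult_2 distrib_left)
  also have "- (\<kappa>^2) + \<kappa>^2 / 2 = - (\<kappa>^2) / 2" by simp
  finally show "(\<integral>z. tail_weight \<kappa> j z \<partial>std_gauss n) = 2 * exp (- (\<kappa>^2) / 2)" .
qed

lemma tail_weight_ge_1:
  assumes j: "j \<in> {1..p}" and \<kappa>: "0 \<le> \<kappa>" and big: "\<kappa> * sqrt (real j) < \<bar>partial_sum (walk z) j\<bar>"
  shows "1 \<le> tail_weight \<kappa> j z"
proof -
  define s where "s = partial_sum (walk z) j / sqrt (real j)"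
  have sj: "sqrt (real j) > 0" using j by simp
  have "\<bar>s\<bar> > \<kappa>" using big sj unfolding s_def abs_divide by (simp add: pos_less_divide_eq)
  hence "\<kappa>^2 \<le> \<kappa> * \<bar>s\<bar>" using \<kappa> unfolding power2_eq_square by (intro mult_left_mono) auto
  hence "exp (\<kappa>^2) \<le> exp (\<kappa> * \<bar>s\<bar>)" by simp
  also have "\<dots> \<le> exp (\<kappa> * s) + exp (- \<kappa> * s)"
    by (cases "s \<ge> 0") (auto simp: add_increasing add_increasing2)
  finally have "exp (- (\<kappa>^2)) * exp (\<kappa>^2) \<le> exp (- (\<kappa>^2)) * (exp (\<kappa> * s) + exp (- \<kappa> * s))"
    by (intro mult_left_mono) auto
  also have "exp (- (\<kappa>^2)) * exp (\<kappa>^2) = 1" by (simp only: exp_add[symmetric]) simp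
  finally show ?thesis unfolding tail_weight_def s_def by simp
qed

text \<open>
  If all partial sums stay within \<open>\<kappa>\<close> standard deviations, the barrier path is used; otherwise a straight
  line, whose cost is about \<open>2 \<Sum> w\<^sup>2\<close>.  The bound \<open>2 \<Sum> w\<^sup>2 \<le> (\<Sum> w\<^sup>4) / p + p\<^sup>2\<close> separates this cost from the
  bad event: the first part has expectation \<open>3\<close>, and the second is multiplied by the tail weights.
\<close>
lemma exists_tracking_path:
  assumes p: "p \<ge> 1" and \<kappa>: "0 \<le> \<kappa>" and T: "12 * \<kappa> * sqrt (real p) \<le> T"
  shows "\<exists>Q. integrable (std_gauss n) Q \<and>
     (\<integral>z. Q z \<partial>std_gauss n) \<le> 64 * (1 + ln (real p)) + 2 * T^2 / real p + 3 + 2 * real p ^ 3 * exp (- (\<kappa>^2) / 2) \<and>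
     (\<forall>z. \<exists>y. y 0 = 0 \<and> y p = T \<and> (\<forall>i\<le>p. 0 \<le> y i \<and> y i \<le> 2 * T) \<and>
        (\<Sum>i=1..p. (walk z i - (y i - y (i - 1)))^2) \<le> Q z)"
proof -
  have T0: "0 \<le> T" using \<kappa> by (intro order_trans[OF _ T]) auto
  interpret prob_space "std_gauss n" by (rule prob_space_std_gauss)
  define A where "A z = (\<Sum>i=1..p. (barrier_slope (walk z) p i)^2)" for z
  define B where "B z = (\<Sum>i=1..p. (walk z i)^4)" for z
  define W where "W z = (\<Sum>j=1..p. tail_weight \<kappa> j z)" for z
  define Q where "Q z = 2 * A z + 2 * T^2 / real p + 1 / real p * B z + (real p)^2 * W z" for z
  have nn: "0 \<le> A z" "0 \<le> B z" "0 \<le> W z" for z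
    unfolding A_def B_def W_def by (rule sum_nonneg, simp add: tail_weight_nonneg)+
  have A: "integrable (std_gauss n) A" "(\<integral>z. A z \<partial>std_gauss n) \<le> 32 * (1 + ln (real p))"
  proof -
    show "integrable (std_gauss n) A" unfolding A_def
      by (rule Bochner_Integration.integrable_sum) (rule barrier_square(1))
    have "(\<integral>z. A z \<partial>std_gauss n) = (\<Sum>i=1..p. \<integral>z. (barrier_slope (walk z) p i)^2 \<partial>std_gauss n)"
      unfolding A_def by (rule Bochner_Integration.integral_sum) (rule barrier_square(1))
    also have "\<dots> \<le> (\<Sum>i=1..p. 32 * (1 / real i))" by (intro sum_mono barrier_square(2))
    also have "\<dots> = 32 * (\<Sum>i=1..p. 1 / real i)" by (simp only: sum_distrib_left)
    also have "\<dots> \<le> 32 * (1 + ln (real p))" using harmonic_sum_le[OF p] by simp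
    finally show "(\<integral>z. A z \<partial>std_gauss n) \<le> 32 * (1 + ln (real p))" .
  qed
  have B: "integrable (std_gauss n) B" "(\<integral>z. B z \<partial>std_gauss n) = 3 * real p"
  proof -
    show "integrable (std_gauss n) B" unfolding B_def
      by (rule Bochner_Integration.integrable_sum) (rule walk_fourth(1))
    have "(\<integral>z. B z \<partial>std_gauss n) = (\<Sum>i=1..p. \<integral>z. (walk z i)^4 \<partial>std_gauss n)"
      unfolding B_def by (rule Bochner_Integration.integral_sum) (rule walk_fourth(1))
    also have "\<dots> = (\<Sum>i=1..p. 3)" by (intro sum.cong refl walk_fourth(2))
    finally show "(\<integral>z. B z \<partial>std_gauss n) = 3 * real p" by simp
  qed
  have W: "integrable (std_gauss n) W" "(\<integral>z. W z \<partial>std_gauss n) = real p * (2 * exp (- (\<kappa>^2) / 2))"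
  proof -
    show "integrable (std_gauss n) W" unfolding W_def
      by (rule Bochner_Integration.integrable_sum) (rule tail_weight_integral(1))
    have "(\<integral>z. W z \<partial>std_gauss n) = (\<Sum>i=1..p. \<integral>z. tail_weight \<kappa> i z \<partial>std_gauss n)"
      unfolding W_def by (rule Bochner_Integration.integral_sum) (rule tail_weight_integral(1))
    also have "\<dots> = (\<Sum>i=1..p. 2 * exp (- (\<kappa>^2) / 2))" by (intro sum.cong refl tail_weight_integral(2))
    finally show "(\<integral>z. W z \<partial>std_gauss n) = real p * (2 * exp (- (\<kappa>^2) / 2))" by simp
  qed
  have "integrable (std_gauss n) Q"
    unfolding Q_def using A(1) B(1) W(1) by simp
  moreover have "(\<integral>z. Q z \<partial>std_gauss n) \<le> 64 * (1 + ln (real p)) + 2 * T^2 / real p + 3 + 2 * real p ^ 3 * exp (- (\<kappa>^2) / 2)"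
  proof -
    have "(\<integral>z. Q z \<partial>std_gauss n) = 2 * (\<integral>z. A z \<partial>std_gauss n) + 2 * T^2 / real p + 
       1 / real p * (3 * real p) + (real p)^2 * (real p * (2 * exp (- (\<kappa>^2) / 2)))"
      unfolding Q_def using A(1) B W by (simp add: prob_space)
    also have "1 / real p * (3 * real p) = 3" using p by simp
    also have "(real p)^2 * (real p * (2 * exp (- (\<kappa>^2) / 2))) = 2 * real p ^ 3 * exp (- (\<kappa>^2) / 2)"
      by (simp add: power2_eq_square power3_eq_cube)
    finally show ?thesis using A(2) by simp
  qed
  moreover have "\<exists>y. y 0 = 0 \<and> y p = T \<and> (\<forall>i\<le>p. 0 \<le> y i \<and> y i \<le> 2 * T) \<and>
        (\<Sum>i=1..p. (walk z i - (y i - y (i - 1)))^2) \<le> Q z" for z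
  proof (cases "\<forall>j\<in>{1..p}. \<bar>partial_sum (walk z) j\<bar> \<le> \<kappa> * sqrt (real j)")
    case True
    have *: "2 * (\<Sum>i=1..p. barrier_slope (walk z) p i) \<le> T"
      using barrier_le_of_sqrt_growth[OF \<kappa>, of p "walk z"] True T by simp
    obtain y where y: "y 0 = 0 \<and> y p = T \<and> (\<forall>i\<le>p. 0 \<le> y i \<and> y i \<le> 2 * T) \<and>
       (\<Sum>i=1..p. (walk z i - (y i - y (i - 1)))^2) \<le> 2 * A z + 2 * T^2 / real p"
      using barrier_path[OF p *] unfolding A_def by (rule exE)
    have "2 * A z + 2 * T^2 / real p \<le> Q z" using nn[of z] unfolding Q_def by simp
    hence "(\<Sum>i=1..p. (walk z i - (y i - y (i - 1)))^2) \<le> Q z"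
      using y by linarith
    thus ?thesis using y by (intro exI[of _ y] conjI) (elim conjE, assumption)+
  next
    case False
    then obtain j where j: "j \<in> {1..p}" "\<kappa> * sqrt (real j) < \<bar>partial_sum (walk z) j\<bar>" by force
    have "1 \<le> tail_weight \<kappa> j z" by (rule tail_weight_ge_1[OF j(1) \<kappa> j(2)])
    also have "\<dots> \<le> W z" unfolding W_def
      using j(1) by (intro member_le_sum tail_weight_nonneg) auto
    finally have W1: "1 \<le> W z" .
    obtain y where y: "y 0 = 0 \<and> y p = T \<and> (\<forall>i\<le>p. 0 \<le> y i \<and> y i \<le> 2 * T) \<and>
       (\<Sum>i=1..p. (walk z i - (y i - y (i - 1)))^2) \<le> 2 * (\<Sum>i=1..p. (walk z i)^2) + 2 * T^2 / real p"
      using linear_path[OF p T0, of "walk z"] by (rule exE)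
    define s where "s = (\<Sum>i=1..p. (walk z i)^2)"
    have "s^2 = (\<Sum>i=1..p. 1 * (walk z i)^2)^2" unfolding s_def by simp
    also have "\<dots> \<le> (\<Sum>i=1..p. 1^2) * (\<Sum>i=1..p. ((walk z i)^2)^2)" by (rule Cauchy_Schwarz_ineq_sum)
    also have "\<dots> = real p * B z" unfolding B_def by simp
    finally have s2: "s^2 \<le> real p * B z" .
    have "0 \<le> (s / real p - real p)^2" by simp
    hence "2 * s \<le> s^2 / (real p)^2 + (real p)^2" using p by (simp add: power2_diff power_divide)
    also have "s^2 / (real p)^2 \<le> (real p * B z) / (real p)^2" using s2 by (rule divide_right_mono) simp
    also have "(real p * B z) / (real p)^2 = 1 / real p * B z" using p by (simp add: power2_eq_square)
    also have "(real p)^2 \<le> (real p)^2 * W z" using mult_left_mono[OF W1, of "(real p)^2"] by simp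
    finally have "2 * s + 2 * T^2 / real p \<le> Q z" using nn[of z] unfolding Q_def by simp
    hence "(\<Sum>i=1..p. (walk z i - (y i - y (i - 1)))^2) \<le> Q z" 
      using y unfolding s_def by linarith
    thus ?thesis using y by (intro exI[of _ y] conjI) (elim conjE, assumption)+
  qed
  ultimately show ?thesis by blast
qed

end

section \<open>Paths between prescribed boundary values\<close>

text \<open>
  For every noise vector there is a path from \<open>\<alpha>\<close> at \<open>a\<close> to \<open>\<beta>\<close> at \<open>b\<close> within \<open>[-L, L]\<close> whose decrements
  match the noise up to a squared error of mean at most \<open>E\<close>.  Bounding the error by an integrable
  function \<open>g\<close> avoids choosing the path measurably.
\<close>
definition bridge :: "nat \<Rightarrow> real \<Rightarrow> nat \<Rightarrow> nat \<Rightarrow> real \<Rightarrow> real \<Rightarrow> real \<Rightarrow> bool" where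
  "bridge n L a b \<alpha> \<beta> E \<longleftrightarrow> (\<exists>g. integrable (std_gauss n) g \<and> (\<integral>z. g z \<partial>std_gauss n) \<le> E \<and>
     (\<forall>z. \<exists>x. x a = \<alpha> \<and> x b = \<beta> \<and> (\<forall>j\<in>{a..b}. \<bar>x j\<bar> \<le> L) \<and>
        (\<Sum>j=a..<b. (z j - (x j - x (j + 1)))^2) \<le> g z))"

lemma bridge_mono: "bridge n L a b \<alpha> \<beta> E \<Longrightarrow> E \<le> E' \<Longrightarrow> bridge n L a b \<alpha> \<beta> E'"
  unfolding bridge_def by (meson order_trans)

lemma bridge_concat:
  assumes "a \<le> m" "m \<le> b" and 1: "bridge n L a m \<alpha> \<gamma> E1" and 2: "bridge n L m b \<gamma> \<beta> E2"
  shows "bridge n L a b \<alpha> \<beta> (E1 + E2)"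
proof -
  obtain g1 where g1: "integrable (std_gauss n) g1" "(\<integral>z. g1 z \<partial>std_gauss n) \<le> E1" and
    p1: "\<And>z. \<exists>x. x a = \<alpha> \<and> x m = \<gamma> \<and> (\<forall>j\<in>{a..m}. \<bar>x j\<bar> \<le> L) \<and>
        (\<Sum>j=a..<m. (z j - (x j - x (j + 1)))^2) \<le> g1 z"
    using 1 unfolding bridge_def by auto
  obtain g2 where g2: "integrable (std_gauss n) g2" "(\<integral>z. g2 z \<partial>std_gauss n) \<le> E2" and
    p2: "\<And>z. \<exists>x. x m = \<gamma> \<and> x b = \<beta> \<and> (\<forall>j\<in>{m..b}. \<bar>x j\<bar> \<le> L) \<and>
        (\<Sum>j=m..<b. (z j - (x j - x (j + 1)))^2) \<le> g2 z"
    using 2 unfolding bridge_def by auto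
  have "\<exists>x. x a = \<alpha> \<and> x b = \<beta> \<and> (\<forall>j\<in>{a..b}. \<bar>x j\<bar> \<le> L) \<and>
        (\<Sum>j=a..<b. (z j - (x j - x (j + 1)))^2) \<le> g1 z + g2 z" for z
  proof -
    obtain x1 where x1: "x1 a = \<alpha>" "x1 m = \<gamma>" "\<forall>j\<in>{a..m}. \<bar>x1 j\<bar> \<le> L"
        "(\<Sum>j=a..<m. (z j - (x1 j - x1 (j + 1)))^2) \<le> g1 z" using p1[of z] by auto
    obtain x2 where x2: "x2 m = \<gamma>" "x2 b = \<beta>" "\<forall>j\<in>{m..b}. \<bar>x2 j\<bar> \<le> L"
        "(\<Sum>j=m..<b. (z j - (x2 j - x2 (j + 1)))^2) \<le> g2 z" using p2[of z] by auto
    define x where "x j = (if j \<le> m then x1 j else x2 j)" for j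
    have xr: "x j = x2 j" if "j \<ge> m" for j
      using that x1(2) x2(1) unfolding x_def by (cases "j = m") auto
    have "(\<Sum>j=a..<b. (z j - (x j - x (j + 1)))^2) = 
       (\<Sum>j=a..<m. (z j - (x j - x (j + 1)))^2) + (\<Sum>j=m..<b. (z j - (x j - x (j + 1)))^2)"
      using assms(1,2) by (simp add: sum.atLeastLessThan_concat)
    also have "(\<Sum>j=a..<m. (z j - (x j - x (j + 1)))^2) = (\<Sum>j=a..<m. (z j - (x1 j - x1 (j + 1)))^2)"
      by (intro sum.cong) (auto simp: x_def)
    also have "(\<Sum>j=m..<b. (z j - (x j - x (j + 1)))^2) = (\<Sum>j=m..<b. (z j - (x2 j - x2 (j + 1)))^2)"
      by (intro sum.cong) (auto simp: xr)
    finally have "(\<Sum>j=a..<b. (z j - (x j - x (j + 1)))^2) \<le> g1 z + g2 z" using x1(4) x2(4) by linarith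
    moreover have "x a = \<alpha>" "x b = \<beta>" using assms(1,2) x1(1) x2(2) xr[of b] by (auto simp: x_def)
    moreover have "\<forall>j\<in>{a..b}. \<bar>x j\<bar> \<le> L"
    proof
      fix j assume "j \<in> {a..b}"
      thus "\<bar>x j\<bar> \<le> L" using x1(3) x2(3) unfolding x_def by (cases "j \<le> m") auto
    qed
    ultimately show ?thesis by blast
  qed
  moreover have "integrable (std_gauss n) (\<lambda>z. g1 z + g2 z)" using g1 g2 by simp
  moreover have "(\<integral>z. g1 z + g2 z \<partial>std_gauss n) \<le> E1 + E2" using g1 g2 by simp
  ultimately show ?thesis unfolding bridge_def by blast
qed

definition half_cost :: "real \<Rightarrow> real \<Rightarrow> nat \<Rightarrow> real" where
  "half_cost \<kappa> T p = 64 * (1 + ln (real p)) + 2 * T^2 / real p + 3 + 2 * real p ^ 3 * exp (- (\<kappa>^2) / 2)"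

text \<open>
  The path leaves the boundary \<open>\<tau> * L\<close> at the left end; \<open>T \<le> L\<close> keeps it away from the opposite boundary
  because the tracking path has height at most \<open>2 * T\<close>.
\<close>
lemma bridge_forward:
  assumes a: "1 \<le> a" "a + p \<le> n + 1" and p: "p \<ge> 1" and \<kappa>: "0 \<le> \<kappa>"
    and T: "12 * \<kappa> * sqrt (real p) \<le> T" "T \<le> L" and \<tau>: "\<tau> = 1 \<or> \<tau> = -1"
  shows "bridge n L a (a + p) (\<tau> * L) (\<tau> * (L - T)) (half_cost \<kappa> T p)"
proof -
  interpret coordinate_walk n p "\<lambda>i. a + i - 1" \<tau>
    using a \<tau> by unfold_locales (auto simp: inj_on_def)
  obtain Q where Q: "integrable (std_gauss n) Q" "(\<integral>z. Q z \<partial>std_gauss n) \<le> half_cost \<kappa> T p"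
    and path: "\<And>z. \<exists>y. y 0 = 0 \<and> y p = T \<and> (\<forall>i\<le>p. 0 \<le> y i \<and> y i \<le> 2 * T) \<and>
        (\<Sum>i=1..p. (\<tau> * z (a + i - 1) - (y i - y (i - 1)))^2) \<le> Q z"
    using exists_tracking_path[OF p \<kappa> T(1)] unfolding half_cost_def by auto
  have "\<exists>x. x a = \<tau> * L \<and> x (a + p) = \<tau> * (L - T) \<and> (\<forall>j\<in>{a..a + p}. \<bar>x j\<bar> \<le> L) \<and>
        (\<Sum>j=a..<a + p. (z j - (x j - x (j + 1)))^2) \<le> Q z" for z
  proof -
    obtain y where y: "y 0 = 0" "y p = T" "\<And>i. i \<le> p \<Longrightarrow> 0 \<le> y i \<and> y i \<le> 2 * T"
      "(\<Sum>i=1..p. (\<tau> * z (a + i - 1) - (y i - y (i - 1)))^2) \<le> Q z"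
      using path[of z] by auto
    define x where "x j = \<tau> * (L - y (j - a))" for j
    have "(\<Sum>j=a..<a + p. (z j - (x j - x (j + 1)))^2) = 
       (\<Sum>i=1..p. (\<tau> * z (a + i - 1) - (y i - y (i - 1)))^2)"
    proof (rule sum.reindex_bij_witness[of _ "\<lambda>i. a + i - 1" "\<lambda>j. j + 1 - a"])
      fix j assume j: "j \<in> {a..<a + p}"
      then obtain i where i: "j = a + i" by (auto simp: le_iff_add)
      have eq: "j + 1 - a = Suc i" "j - a = i" "a + Suc i - 1 = j" "Suc i - 1 = i"
        unfolding i by auto
      show "(\<tau> * z (a + (j + 1 - a) - 1) - (y (j + 1 - a) - y (j + 1 - a - 1)))^2 = (z j - (x j - x (j + 1)))^2"
        unfolding eq x_def using \<tau> by (auto simp: power2_eq_square algebra_simps)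
    qed auto
    moreover have "\<bar>x j\<bar> \<le> L" if "j \<in> {a..a + p}" for j
    proof -
      have "j - a \<le> p" using that by auto
      from y(3)[OF this] show ?thesis using \<tau> T(2) unfolding x_def abs_le_iff by (elim disjE) auto
    qed
    ultimately show ?thesis using y by (intro exI[of _ x]) (auto simp: x_def)
  qed
  thus ?thesis using Q unfolding bridge_def by blast
qed

text \<open>
  The mirror image of \<open>bridge_forward\<close>: the piece is read from its right end, which reverses the sign of
  the increments.
\<close>
lemma bridge_backward:
  assumes a: "1 \<le> a" "a + p \<le> n + 1" and p: "p \<ge> 1" and \<kappa>: "0 \<le> \<kappa>"
    and T: "12 * \<kappa> * sqrt (real p) \<le> T" "T \<le> L" and \<tau>: "\<tau> = 1 \<or> \<tau> = -1"
  shows "bridge n L a (a + p) (\<tau> * (L - T)) (\<tau> * L) (half_cost \<kappa> T p)"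
proof -
  interpret coordinate_walk n p "\<lambda>i. a + p - i" "-\<tau>"
    using a \<tau> by unfold_locales (auto simp: inj_on_def)
  obtain Q where Q: "integrable (std_gauss n) Q" "(\<integral>z. Q z \<partial>std_gauss n) \<le> half_cost \<kappa> T p"
    and path: "\<And>z. \<exists>y. y 0 = 0 \<and> y p = T \<and> (\<forall>i\<le>p. 0 \<le> y i \<and> y i \<le> 2 * T) \<and>
        (\<Sum>i=1..p. (- \<tau> * z (a + p - i) - (y i - y (i - 1)))^2) \<le> Q z"
    using exists_tracking_path[OF p \<kappa> T(1)] unfolding half_cost_def by auto
  have "\<exists>x. x a = \<tau> * (L - T) \<and> x (a + p) = \<tau> * L \<and> (\<forall>j\<in>{a..a + p}. \<bar>x j\<bar> \<le> L) \<and>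
        (\<Sum>j=a..<a + p. (z j - (x j - x (j + 1)))^2) \<le> Q z" for z
  proof -
    obtain y where y: "y 0 = 0" "y p = T" "\<And>i. i \<le> p \<Longrightarrow> 0 \<le> y i \<and> y i \<le> 2 * T"
      "(\<Sum>i=1..p. (- \<tau> * z (a + p - i) - (y i - y (i - 1)))^2) \<le> Q z"
      using path[of z] by auto
    define x where "x j = \<tau> * (L - y (a + p - j))" for j
    have "(\<Sum>j=a..<a + p. (z j - (x j - x (j + 1)))^2) = 
       (\<Sum>i=1..p. (- \<tau> * z (a + p - i) - (y i - y (i - 1)))^2)"
    proof (rule sum.reindex_bij_witness[of _ "\<lambda>i. a + p - i" "\<lambda>j. a + p - j"])
      fix j assume j: "j \<in> {a..<a + p}"
      define i where "i = a + p - (j + 1)"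
      have eq: "a + p - j = Suc i" "a + p - Suc i = j" "Suc i - 1 = i" "a + p - (j + 1) = i"
        using j unfolding i_def by auto
      show "(- \<tau> * z (a + p - (a + p - j)) - (y (a + p - j) - y (a + p - j - 1)))^2 = (z j - (x j - x (j + 1)))^2"
        unfolding x_def eq using \<tau> by (auto simp: power2_eq_square algebra_simps)
    qed auto
    moreover have "\<bar>x j\<bar> \<le> L" if "j \<in> {a..a + p}" for j
    proof -
      have "a + p - j \<le> p" using that by auto
      from y(3)[OF this] show ?thesis using \<tau> T(2) unfolding x_def abs_le_iff by (elim disjE) auto
    qed
    ultimately show ?thesis using y by (intro exI[of _ x]) (auto simp: x_def)
  qed
  thus ?thesis using Q unfolding bridge_def by blast
qed

lemma bridge_single:
  assumes a: "a \<in> {1..n}" and "\<bar>\<alpha>\<bar> \<le> L" "\<bar>\<beta>\<bar> \<le> L"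
  shows "bridge n L a (a + 1) \<alpha> \<beta> (2 + 2 * (\<alpha> - \<beta>)^2)"
proof -
  interpret prob_space "std_gauss n" by (rule prob_space_std_gauss)
  note sq = std_gauss_square[OF a]
  have "\<exists>x. x a = \<alpha> \<and> x (a + 1) = \<beta> \<and> (\<forall>j\<in>{a..a + 1}. \<bar>x j\<bar> \<le> L) \<and>
        (\<Sum>j=a..<a + 1. (z j - (x j - x (j + 1)))^2) \<le> 2 * (z a)^2 + 2 * (\<alpha> - \<beta>)^2" for z :: "nat \<Rightarrow> real"
    using assms square_diff_le[of "z a" "\<alpha> - \<beta>"]
    by (intro exI[of _ "\<lambda>j. if j = a then \<alpha> else \<beta>"]) auto
  moreover have "integrable (std_gauss n) (\<lambda>z. 2 * (z a)^2 + 2 * (\<alpha> - \<beta>)^2)" using sq by simp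
  moreover have "(\<integral>z. 2 * (z a)^2 + 2 * (\<alpha> - \<beta>)^2 \<partial>std_gauss n) \<le> 2 + 2 * (\<alpha> - \<beta>)^2"
    using sq by (simp add: prob_space)
  ultimately show ?thesis unfolding bridge_def by blast
qed

text \<open>
  Pieces of length at most \<open>X\<close> are tracked in the strip \<open>[-height, height]\<close>.  The factor \<open>6\<close> in \<open>kap\<close> makes
  the tail \<open>exp (- kap\<^sup>2 / 2) = (e X)\<^sup>-\<^sup>3\<close> cancel the \<open>p\<^sup>3\<close> of \<open>half_cost\<close>, and the factor \<open>12\<close> in \<open>height\<close> is
  the one that \<open>exists_tracking_path\<close> demands.
\<close>
locale tracking_scale =
  fixes X :: real
  assumes X: "1 \<le> X"
begin

definition logX :: real where "logX = 1 + ln X"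
definition kap :: real where "kap = sqrt (6 * logX)"
definition height :: real where "height = 12 * kap * sqrt X"

lemma logX_ge_1: "1 \<le> logX" using X by (simp add: logX_def)
lemma kap_nonneg: "0 \<le> kap" using logX_ge_1 by (simp add: kap_def)
lemma kap_square: "kap^2 = 6 * logX" using logX_ge_1 by (simp add: kap_def)
lemma height_square: "height^2 = 864 * logX * X"
  using X by (simp add: height_def power_mult_distrib kap_square)
lemma height_pos: "0 < height"
  using X logX_ge_1 by (simp add: height_def kap_def)

lemma half_cost_le:
  assumes p: "1 \<le> p" "real p \<le> X"
  shows "half_cost kap T p \<le> 69 * logX + 2 * T^2 / real p"
proof -
  have lnp: "ln (real p) \<le> ln X" using p by simp
  have "real p ^ 3 = exp (3 * ln (real p))"
    using p exp_of_nat_mult[of 3 "ln (real p)"] by simp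
  hence "real p ^ 3 * exp (- (kap^2) / 2) = exp (3 * ln (real p) - 3 * logX)"
    by (simp add: kap_square exp_diff exp_minus field_simps)
  also have "\<dots> \<le> 1" using lnp by (simp add: logX_def)
  finally have "2 * real p ^ 3 * exp (- (kap^2) / 2) \<le> 2" by simp
  moreover have "64 * (1 + ln (real p)) \<le> 64 * logX" using lnp by (simp add: logX_def)
  ultimately show ?thesis using logX_ge_1 unfolding half_cost_def by linarith
qed

lemma kap_sqrt_le_height: "real p \<le> X \<Longrightarrow> 12 * kap * sqrt (real p) \<le> height"
  unfolding height_def using kap_nonneg by (intro mult_left_mono) auto

lemma half_height_cost:
  assumes p: "1 \<le> p" "real p \<le> X" and r: "X \<le> 3 * r * real p" "1 \<le> r"
  shows "half_cost kap height p \<le> 5253 * r * logX"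
proof -
  have "2 * height^2 / real p = 1728 * logX * (X / real p)" by (simp add: height_square)
  also have "\<dots> \<le> 1728 * logX * (3 * r)"
    using p r logX_ge_1 by (intro mult_left_mono) (auto simp: divide_le_eq)
  also have "\<dots> = 5184 * (r * logX)" by simp
  finally have "half_cost kap height p \<le> 69 * logX + 5184 * (r * logX)"
    by (intro order_trans[OF half_cost_le[OF p]] add_left_mono)
  also have "69 * logX \<le> 69 * (r * logX)" using r logX_ge_1 by simp
  finally show ?thesis by simp
qed

text \<open>
  A piece longer than \<open>X\<close> is cut at most \<open>2 * len / X\<close> times, each part costing at most
  \<open>11000 * r * logX\<close>; the number \<open>11000\<close> leaves room for two halves of cost \<open>5253 * r * logX\<close>.
\<close>
definition piece_budget :: "real \<Rightarrow> nat \<Rightarrow> real" where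
  "piece_budget r len = (1 + 2 * real len / X) * (11000 * r * logX)"

lemma piece_budget_ge: "1 \<le> r \<Longrightarrow> 11000 * r * logX \<le> piece_budget r len"
  unfolding piece_budget_def using X logX_ge_1 by simp

text \<open>
  A path between a boundary and \<open>0\<close> is a single tracking path of full height \<open>T = height\<close>, and a path
  from one boundary to the other consists of two of them.  The resulting drift cost \<open>height\<^sup>2 / len\<close> is of
  order \<open>logX\<close> only because \<open>len\<close> is comparable to \<open>X\<close>.
\<close>
lemma bridge_change:
  assumes a: "1 \<le> a" "a + len \<le> n + 1" and len: "1 \<le> len" "real len \<le> X" "X \<le> r * real len" and r: "1 \<le> r"
    and s: "s \<in> {-1, 0, 1}" "s' \<in> {-1, 0, 1}" "s \<noteq> s'"
  shows "bridge n height a (a + len) (s * height) (s' * height) (11000 * r * logX)"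
proof -
  have rl: "0 \<le> r * logX" using r logX_ge_1 by simp
  have h: "half_cost kap height len \<le> 11000 * r * logX"
  proof -
    have "r * real len \<le> 3 * r * real len" using r by simp
    hence "half_cost kap height len \<le> 5253 * r * logX" using len r by (intro half_height_cost) auto
    thus ?thesis using rl by simp
  qed
  consider (up) "s = 0" "s' = 1 \<or> s' = -1" | (down) "s' = 0" "s = 1 \<or> s = -1"
    | (cross) "s' = - s" "s = 1 \<or> s = -1" using s by auto
  thus ?thesis
  proof cases
    case up
    have "bridge n height a (a + len) (s' * (height - height)) (s' * height) (half_cost kap height len)"
      using a len up by (intro bridge_backward kap_nonneg kap_sqrt_le_height) auto
    thus ?thesis using up h by (auto intro: bridge_mono)
  next
    case down
    have "bridge n height a (a + len) (s * height) (s * (height - height)) (half_cost kap height len)"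
      using a len down by (intro bridge_forward kap_nonneg kap_sqrt_le_height) auto
    thus ?thesis using down h by (auto intro: bridge_mono)
  next
    case cross
    show ?thesis
    proof (cases "len = 1")
      case True
      have "bridge n height a (a + 1) (s * height) (s' * height) (2 + 2 * (s * height - s' * height)^2)"
        using a True s height_pos by (intro bridge_single) (auto simp: abs_mult)
      moreover have "(s * height - s' * height)^2 = 4 * (864 * logX * X)"
        unfolding height_square[symmetric] using cross by (auto simp: power2_eq_square algebra_simps)
      moreover have "logX * X \<le> logX * r" using len True logX_ge_1 by (intro mult_left_mono) auto
      moreover have "2 \<le> 2 * (r * logX)" using mult_mono[OF r logX_ge_1] r by simp
      ultimately show ?thesis unfolding True using rl
        by (elim bridge_mono) (simp add: algebra_simps)
    next
      case False
      define p where "p = len div 2"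
      define q where "q = len - p"
      have pq: "1 \<le> p" "1 \<le> q" "len = p + q" "len \<le> 3 * p" "len \<le> 3 * q"
        using False len(1) unfolding p_def q_def by auto
      have h': "half_cost kap height l \<le> 5253 * r * logX" if "1 \<le> l" "l \<le> len" "len \<le> 3 * l" for l
      proof (rule half_height_cost[OF that(1) _ _ r])
        show "real l \<le> X" using that len by linarith
        have "r * real len \<le> r * (3 * real l)" using that r by (intro mult_left_mono) auto
        thus "X \<le> 3 * r * real l" using len(3) by (simp add: algebra_simps)
      qed
      have "bridge n height a (a + p) (s * height) (s * (height - height)) (half_cost kap height p)"
        using a len cross pq by (intro bridge_forward kap_nonneg kap_sqrt_le_height) auto
      moreover have "bridge n height (a + p) (a + p + q) (s' * (height - height)) (s' * height) (half_cost kap height q)"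
        using a len cross pq by (intro bridge_backward kap_nonneg kap_sqrt_le_height) auto
      ultimately have "bridge n height a (a + p + q) (s * height) (s' * height) (half_cost kap height p + half_cost kap height q)"
        by (intro bridge_concat[of a "a + p"]) auto
      moreover have "half_cost kap height p + half_cost kap height q \<le> 11000 * r * logX"
        using h'[of p] h'[of q] pq rl by simp
      ultimately show ?thesis using pq(3) by (auto intro: bridge_mono simp: add.assoc)
    qed
  qed
qed

text \<open>
  A path from a boundary back to itself.  Unlike at a sign change there is no lower bound on the length,
  so the excursion height \<open>T\<close> is adapted to \<open>sqrt len\<close>, which keeps \<open>T\<^sup>2 / len\<close> of order \<open>logX\<close>.
\<close>
lemma bridge_constant_short:
  assumes a: "1 \<le> a" "a + len \<le> n + 1" and len: "1 \<le> len" "real len \<le> X" and s: "s = 1 \<or> s = -1"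
  shows "bridge n height a (a + len) (s * height) (s * height) (11000 * logX)"
proof (cases "len = 1")
  case True
  have "bridge n height a (a + 1) (s * height) (s * height) (2 + 2 * (s * height - s * height)^2)"
    using a True s height_pos by (intro bridge_single) (auto simp: abs_mult)
  thus ?thesis unfolding True using logX_ge_1 by (elim bridge_mono) simp
next
  case False
  define p where "p = len div 2"
  define q where "q = len - p"
  have pq: "1 \<le> p" "1 \<le> q" "len = p + q" "len \<le> 3 * p" "len \<le> 3 * q"
    using False len(1) unfolding p_def q_def by auto
  define T where "T = 12 * kap * sqrt (real len)"
  have T2: "T^2 = 864 * logX * real len"
    by (simp add: T_def power_mult_distrib kap_square)
  have TL: "T \<le> height" unfolding T_def by (rule kap_sqrt_le_height[OF len(2)])
  have T: "12 * kap * sqrt (real l) \<le> T" if "l \<le> len" for l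
    unfolding T_def using kap_nonneg that by (intro mult_left_mono) auto
  have h: "half_cost kap T l \<le> 5253 * logX" if "1 \<le> l" "l \<le> len" "len \<le> 3 * l" for l
  proof -
    have "2 * T^2 / real l = 1728 * logX * (real len / real l)" by (simp add: T2)
    also have "\<dots> \<le> 1728 * logX * 3"
      using that logX_ge_1 by (intro mult_left_mono) (auto simp: divide_le_eq)
    finally show ?thesis using half_cost_le[of l T] that len by simp
  qed
  have "bridge n height a (a + p) (s * height) (s * (height - T)) (half_cost kap T p)"
    using a len pq s TL T[of p] by (intro bridge_forward kap_nonneg) auto
  moreover have "bridge n height (a + p) (a + p + q) (s * (height - T)) (s * height) (half_cost kap T q)"
    using a len pq s TL T[of q] by (intro bridge_backward kap_nonneg) auto
  ultimately have "bridge n height a (a + p + q) (s * height) (s * height) (half_cost kap T p + half_cost kap T q)"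
    by (intro bridge_concat[of a "a + p"]) auto
  moreover have "half_cost kap T p + half_cost kap T q \<le> 11000 * logX"
    using h[of p] h[of q] pq logX_ge_1 by simp
  ultimately show ?thesis using pq(3) by (auto intro: bridge_mono simp: add.assoc)
qed

text \<open>
  Long pieces are handled by returning to the boundary after every \<open>\<lfloor>X\<rfloor> \<ge> X / 2\<close> steps.
\<close>
lemma bridge_constant:
  assumes "1 \<le> a" "a + len \<le> n + 1" "1 \<le> len" "s = 1 \<or> s = -1"
  shows "bridge n height a (a + len) (s * height) (s * height) (piece_budget 1 len)"
  using assms
proof (induction len arbitrary: a rule: less_induct)
  case (less len)
  show ?case
  proof (cases "real len \<le> X")
    case True
    have "11000 * logX \<le> piece_budget 1 len" using piece_budget_ge[of 1 len] by simp
    with bridge_constant_short[OF less.prems(1-3) True less.prems(4)] show ?thesis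
      by (rule bridge_mono)
  next
    case False
    define m where "m = nat \<lfloor>X\<rfloor>"
    have m: "1 \<le> m" "real m \<le> X" "X \<le> 2 * real m" 
    proof -
      have "real m = of_int \<lfloor>X\<rfloor>" "1 \<le> \<lfloor>X\<rfloor>" using X unfolding m_def by auto
      thus "1 \<le> m" "real m \<le> X" "X \<le> 2 * real m" by linarith+
    qed
    hence mlen: "m < len" using False by linarith
    define l where "l = len - m"
    have l: "len = m + l" "1 \<le> l" "l < len" using mlen m unfolding l_def by auto
    have "bridge n height a (a + m) (s * height) (s * height) (11000 * logX)"
      using less.prems m l by (intro bridge_constant_short) auto
    moreover have "bridge n height (a + m) (a + m + l) (s * height) (s * height) (piece_budget 1 l)"
      using less.prems m l by (intro less.IH) auto
    ultimately have "bridge n height a (a + m + l) (s * height) (s * height) (11000 * logX + piece_budget 1 l)"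
      by (intro bridge_concat[of a "a + m"]) auto
    moreover have "11000 * logX + piece_budget 1 l \<le> piece_budget 1 len"
    proof -
      have "1 \<le> 2 * real m / X" using m X by simp
      hence "1 * (11000 * logX) \<le> 2 * real m / X * (11000 * logX)"
        using logX_ge_1 by (intro mult_right_mono) auto
      thus ?thesis unfolding piece_budget_def l(1) by (simp add: algebra_simps add_divide_distrib)
    qed
    ultimately show ?thesis using l(1) by (auto intro: bridge_mono simp: add.assoc)
  qed
qed

lemma bridge_piece:
  assumes a: "1 \<le> a" "a + len \<le> n + 1" and len: "1 \<le> len" and r: "1 \<le> r"
    and s: "s \<in> {-1, 0, 1}" "s' \<in> {-1, 0, 1}" "s \<noteq> 0 \<or> s' \<noteq> 0"
    and change: "s \<noteq> s' \<Longrightarrow> real len \<le> X \<and> X \<le> r * real len"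
  shows "bridge n height a (a + len) (s * height) (s' * height) (piece_budget r len)"
proof (cases "s = s'")
  case True
  have "bridge n height a (a + len) (s * height) (s * height) (piece_budget 1 len)"
    using True s by (intro bridge_constant a len) auto
  moreover have "piece_budget 1 len \<le> piece_budget r len"
    unfolding piece_budget_def using r X logX_ge_1 by (intro mult_left_mono mult_right_mono) auto
  ultimately show ?thesis using True by (auto intro: bridge_mono)
next
  case False
  thus ?thesis using change
    by (intro bridge_mono[OF bridge_change[OF a len _ _ r s(1,2)] piece_budget_ge[OF r]]) auto
qed

lemma bridge_pieces:
  fixes q :: "nat \<Rightarrow> nat" and s :: "nat \<Rightarrow> real"
  assumes q0: "1 \<le> q 0" and inc: "\<And>i. i < m \<Longrightarrow> q i < q (Suc i)" and qm: "q m \<le> n + 1" and r: "1 \<le> r"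
    and s: "\<And>i. i \<le> m \<Longrightarrow> s i \<in> {-1, 0, 1}" "\<And>i. i < m \<Longrightarrow> s i \<noteq> 0 \<or> s (Suc i) \<noteq> 0"
    and change: "\<And>i. i < m \<Longrightarrow> s i \<noteq> s (Suc i) \<Longrightarrow> 
       real (q (Suc i) - q i) \<le> X \<and> X \<le> r * real (q (Suc i) - q i)"
  shows "\<exists>g. integrable (std_gauss n) g \<and> 
     (\<integral>z. g z \<partial>std_gauss n) \<le> (real m + 2 * real (q m - q 0) / X) * (11000 * r * logX) \<and>
     (\<forall>z. \<exists>x. (\<forall>i\<le>m. x (q i) = s i * height) \<and> (\<forall>j\<in>{q 0..q m}. \<bar>x j\<bar> \<le> height) \<and>
        (\<Sum>j=q 0..<q m. (z j - (x j - x (j + 1)))^2) \<le> g z)"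
  using inc qm s change
proof (induction m)
  case 0
  have "\<bar>s 0\<bar> * height \<le> 1 * height" using 0(3)[of 0] height_pos by (intro mult_right_mono) auto
  thus ?case using height_pos by (intro exI[of _ "\<lambda>_. 0"]) (auto simp: abs_mult)
next
  case (Suc m)
  have qq: "q m < q (Suc m)" using Suc.prems(1)[of m] by simp
  have qmn: "q m \<le> n + 1" using qq Suc.prems(2) by linarith
  have q0m: "q 0 \<le> q i" if "i \<le> m" for i
    using that
  proof (induction i)
    case (Suc i)
    thus ?case using \<open>\<And>i. i < Suc m \<Longrightarrow> q i < q (Suc i)\<close>[of i] by simp
  qed simp
  have qim: "q i \<le> q m" if "i \<le> m" for i
    using that
  proof (induction rule: inc_induct)
    case (step i)
    thus ?case using Suc.prems(1)[of i] by simp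
  qed simp
  have "\<exists>g. integrable (std_gauss n) g \<and> 
     (\<integral>z. g z \<partial>std_gauss n) \<le> (real m + 2 * real (q m - q 0) / X) * (11000 * r * logX) \<and>
     (\<forall>z. \<exists>x. (\<forall>i\<le>m. x (q i) = s i * height) \<and> (\<forall>j\<in>{q 0..q m}. \<bar>x j\<bar> \<le> height) \<and>
        (\<Sum>j=q 0..<q m. (z j - (x j - x (j + 1)))^2) \<le> g z)"
    using Suc.prems qmn by (intro Suc.IH) auto
  then obtain g1 where g1: "integrable (std_gauss n) g1" 
     "(\<integral>z. g1 z \<partial>std_gauss n) \<le> (real m + 2 * real (q m - q 0) / X) * (11000 * r * logX)"
    and p1: "\<And>z. \<exists>x. (\<forall>i\<le>m. x (q i) = s i * height) \<and> (\<forall>j\<in>{q 0..q m}. \<bar>x j\<bar> \<le> height) \<and>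
        (\<Sum>j=q 0..<q m. (z j - (x j - x (j + 1)))^2) \<le> g1 z" by auto
  have "bridge n height (q m) (q m + (q (Suc m) - q m)) (s m * height) (s (Suc m) * height) 
      (piece_budget r (q (Suc m) - q m))"
  proof (rule bridge_piece[OF _ _ _ r])
    show "1 \<le> q m" "q m + (q (Suc m) - q m) \<le> n + 1" "1 \<le> q (Suc m) - q m"
      using q0 q0m[of m] qq Suc.prems(2) by linarith+
  qed (use Suc.prems in auto)
  hence "bridge n height (q m) (q (Suc m)) (s m * height) (s (Suc m) * height) 
      (piece_budget r (q (Suc m) - q m))" using qq by simp
  then obtain g2 where g2: "integrable (std_gauss n) g2" "(\<integral>z. g2 z \<partial>std_gauss n) \<le> piece_budget r (q (Suc m) - q m)"
    and p2: "\<And>z. \<exists>x. x (q m) = s m * height \<and> x (q (Suc m)) = s (Suc m) * height \<and> 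
        (\<forall>j\<in>{q m..q (Suc m)}. \<bar>x j\<bar> \<le> height) \<and>
        (\<Sum>j=q m..<q (Suc m). (z j - (x j - x (j + 1)))^2) \<le> g2 z"
    unfolding bridge_def by auto
  have "\<exists>x. (\<forall>i\<le>Suc m. x (q i) = s i * height) \<and> (\<forall>j\<in>{q 0..q (Suc m)}. \<bar>x j\<bar> \<le> height) \<and>
        (\<Sum>j=q 0..<q (Suc m). (z j - (x j - x (j + 1)))^2) \<le> g1 z + g2 z" for z
  proof -
    obtain x1 where x1: "\<And>i. i \<le> m \<Longrightarrow> x1 (q i) = s i * height" "\<And>j. j \<in> {q 0..q m} \<Longrightarrow> \<bar>x1 j\<bar> \<le> height"
        "(\<Sum>j=q 0..<q m. (z j - (x1 j - x1 (j + 1)))^2) \<le> g1 z"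
      using p1[of z] by (elim exE conjE) blast
    obtain x2 where x2: "x2 (q m) = s m * height" "x2 (q (Suc m)) = s (Suc m) * height" 
        "\<And>j. j \<in> {q m..q (Suc m)} \<Longrightarrow> \<bar>x2 j\<bar> \<le> height"
        "(\<Sum>j=q m..<q (Suc m). (z j - (x2 j - x2 (j + 1)))^2) \<le> g2 z"
      using p2[of z] by (elim exE conjE) blast
    define x where "x j = (if j \<le> q m then x1 j else x2 j)" for j
    have xr: "x j = x2 j" if "j \<ge> q m" for j
      using that x1(1)[of m] x2(1) unfolding x_def by (cases "j = q m") auto
    have "(\<Sum>j=q 0..<q (Suc m). (z j - (x j - x (j + 1)))^2) = 
       (\<Sum>j=q 0..<q m. (z j - (x j - x (j + 1)))^2) + (\<Sum>j=q m..<q (Suc m). (z j - (x j - x (j + 1)))^2)"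
      using q0m[of m] qq by (simp add: sum.atLeastLessThan_concat)
    also have "(\<Sum>j=q 0..<q m. (z j - (x j - x (j + 1)))^2) = (\<Sum>j=q 0..<q m. (z j - (x1 j - x1 (j + 1)))^2)"
      by (intro sum.cong) (auto simp: x_def)
    also have "(\<Sum>j=q m..<q (Suc m). (z j - (x j - x (j + 1)))^2) = (\<Sum>j=q m..<q (Suc m). (z j - (x2 j - x2 (j + 1)))^2)"
      by (intro sum.cong) (auto simp: xr)
    finally have "(\<Sum>j=q 0..<q (Suc m). (z j - (x j - x (j + 1)))^2) \<le> g1 z + g2 z" using x1(3) x2(4) by linarith
    moreover have "x (q i) = s i * height" if "i \<le> Suc m" for i
    proof (cases "i = Suc m")
      case True
      thus ?thesis using xr[of "q i"] x2(2) qq by simp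
    next
      case False
      thus ?thesis using that x1(1)[of i] qim[of i] by (simp add: x_def)
    qed
    moreover have "\<bar>x j\<bar> \<le> height" if "j \<in> {q 0..q (Suc m)}" for j
      using x1(2)[of j] x2(3)[of j] that unfolding x_def by (cases "j \<le> q m") auto
    ultimately show ?thesis by blast
  qed
  moreover have "integrable (std_gauss n) (\<lambda>z. g1 z + g2 z)" using g1 g2 by simp
  moreover have "(\<integral>z. g1 z + g2 z \<partial>std_gauss n) \<le> (real (Suc m) + 2 * real (q (Suc m) - q 0) / X) * (11000 * r * logX)"
  proof -
    have "(real m + 2 * real (q m - q 0) / X) + (1 + 2 * real (q (Suc m) - q m) / X) = 
       real (Suc m) + 2 * real (q (Suc m) - q 0) / X"
      using q0m[of m] qq by (simp add: add_divide_distrib[symmetric] of_nat_diff)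
    hence "(real m + 2 * real (q m - q 0) / X) * (11000 * r * logX) + piece_budget r (q (Suc m) - q m) = 
       (real (Suc m) + 2 * real (q (Suc m) - q 0) / X) * (11000 * r * logX)"
      unfolding piece_budget_def distrib_right[symmetric] by simp
    thus ?thesis using g1 g2 by simp
  qed
  ultimately show ?case by (intro exI[of _ "\<lambda>z. g1 z + g2 z"]) blast
qed

end

section \<open>Subgradients of the total variation\<close>

lemma sum_by_parts:
  fixes u \<eta> :: "nat \<Rightarrow> real"
  assumes "1 \<le> n"
  shows "(\<Sum>j=1..n. (u j - u (j + 1)) * \<eta> j) =
     u 1 * \<eta> 1 - u (n + 1) * \<eta> n + (\<Sum>i=1..n-1. u (i + 1) * (\<eta> (i + 1) - \<eta> i))"
  using assms
proof (induction n rule: nat_induct_at_least)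
  case (Suc n)
  then obtain m where m: "n = Suc m" by (cases n) auto
  show ?case using Suc.IH unfolding m by (simp add: algebra_simps)
qed (simp add: algebra_simps)

text \<open>
  The pieces of constancy are the intervals \<open>{q i..<q (i + 1)}\<close> for \<open>i \<le> k\<close>, with \<open>q 0 = 1\<close> and
  \<open>q (k + 1) = n + 1\<close>; the sign convention \<open>s 0 = s (k + 1) = 0\<close> fits the dual paths, which vanish at both
  ends.
\<close>
locale signal =
  fixes n :: nat and \<theta> :: "nat \<Rightarrow> real"
  assumes n: "2 \<le> n" and \<theta>: "\<theta> \<in> Rn n" and has_jump: "1 \<le> num_jumps n \<theta>"
begin

abbreviation k :: nat where "k \<equiv> num_jumps n \<theta>"
abbreviation s :: "nat \<Rightarrow> real" where "s i \<equiv> real_of_int (jump_sign n \<theta> i)"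

definition q :: "nat \<Rightarrow> nat" where
  "q i = (if i = 0 then 1 else if i = k + 1 then n + 1 else jump n \<theta> i)"

abbreviation piece :: "nat \<Rightarrow> nat set" where "piece i \<equiv> {q i..<q (i + 1)}"

lemma finite_jumps: "finite (jumps n \<theta>)"
  by (simp add: jumps_def)

lemma jump_in: "i \<in> {1..k} \<Longrightarrow> jump n \<theta> i \<in> jumps n \<theta>"
proof -
  assume i: "i \<in> {1..k}"
  hence "jump n \<theta> i \<in> set (sorted_list_of_set (jumps n \<theta>))"
    unfolding jump_def by (intro nth_mem) (auto simp: num_jumps_def)
  thus ?thesis using finite_jumps by simp
qed

lemma jump_surj: "j \<in> jumps n \<theta> \<Longrightarrow> \<exists>i\<in>{1..k}. jump n \<theta> i = j"
proof -
  assume "j \<in> jumps n \<theta>"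
  hence "j \<in> set (sorted_list_of_set (jumps n \<theta>))" using finite_jumps by simp
  then obtain l where "l < k" "sorted_list_of_set (jumps n \<theta>) ! l = j"
    unfolding in_set_conv_nth by (auto simp: num_jumps_def)
  thus ?thesis unfolding jump_def by (intro bexI[of _ "Suc l"]) auto
qed

lemma q_0 [simp]: "q 0 = 1" and q_last [simp]: "q (Suc k) = n + 1"
  by (simp_all add: q_def)

lemma q_jump: "i \<in> {1..k} \<Longrightarrow> q i = jump n \<theta> i"
  by (auto simp: q_def)

lemma q_less: "i \<le> k \<Longrightarrow> q i < q (Suc i)"
proof -
  assume i: "i \<le> k"
  consider "i = 0" | "i \<ge> 1" "i = k" | "i \<ge> 1" "i < k" using i by linarith
  thus ?thesis
  proof cases
    case 1
    thus ?thesis using has_jump jump_in[of 1] q_jump[of 1] by (auto simp: jumps_def)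
  next
    case 2
    thus ?thesis using jump_in[of k] q_jump[of k] has_jump by (auto simp: jumps_def)
  next
    case 3
    have "sorted_list_of_set (jumps n \<theta>) ! (i - 1) < sorted_list_of_set (jumps n \<theta>) ! i"
      using 3 by (intro sorted_wrt_nth_less[OF strict_sorted_list_of_set]) (auto simp: num_jumps_def)
    thus ?thesis using 3 by (simp add: q_jump jump_def)
  qed
qed

lemma q_mono: "i \<le> j \<Longrightarrow> j \<le> Suc k \<Longrightarrow> q i \<le> q j"
proof (induction j rule: dec_induct)
  case (step j)
  thus ?case using q_less[of j] by simp
qed simp

lemma q_ge_1: "i \<le> Suc k \<Longrightarrow> 1 \<le> q i"
  using q_mono[of 0 i] by simp

lemma q_le: "i \<le> Suc k \<Longrightarrow> q i \<le> n + 1"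
  using q_mono[of i "Suc k"] by simp

lemma piece_length_eq: "i \<le> k \<Longrightarrow> piece_length n \<theta> i = q (i + 1) - q i"
  using has_jump by (auto simp: piece_length_def q_def)

lemma sign_values: "s i \<in> {-1, 0, 1}"
  by (simp add: jump_sign_def)

lemma sign_boundary: "s 0 = 0" "s (Suc k) = 0"
  by (simp_all add: jump_sign_def)

lemma sign_jump: "i \<in> {1..k} \<Longrightarrow> s i = sgn (\<theta> (q i) - \<theta> (q i - 1))"
  using jump_in[of i] by (auto simp: jump_sign_def q_jump jumps_def)

lemma sign_nonzero: "i \<in> {1..k} \<Longrightarrow> s i \<noteq> 0"
  by (simp add: jump_sign_def)

lemma piece_exists: "j \<in> {1..n} \<Longrightarrow> \<exists>i\<le>k. j \<in> piece i"
proof -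
  assume j: "j \<in> {1..n}"
  define I where "I = {i. i \<le> k \<and> q i \<le> j}"
  have I: "finite I" "0 \<in> I" using j unfolding I_def by auto
  define i where "i = Max I"
  have i: "i \<in> I" unfolding i_def using I by (intro Max_in) auto
  have "\<not> q (i + 1) \<le> j"
  proof
    assume *: "q (i + 1) \<le> j"
    have "i + 1 \<le> k"
    proof (rule ccontr)
      assume "\<not> i + 1 \<le> k"
      hence "i = k" using i unfolding I_def by simp
      thus False using * j by simp
    qed
    hence "i + 1 \<in> I" using * unfolding I_def by simp
    hence "i + 1 \<le> i" unfolding i_def using I(1) by (intro Max_ge)
    thus False by simp
  qed
  thus ?thesis using i unfolding I_def by (intro exI[of _ i]) auto
qed

lemma piece_unique: "j \<in> piece i \<Longrightarrow> j \<in> piece i' \<Longrightarrow> i \<le> k \<Longrightarrow> i' \<le> k \<Longrightarrow> i = i'"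
proof (rule ccontr)
  assume *: "j \<in> piece i" "j \<in> piece i'" "i \<le> k" "i' \<le> k" "i \<noteq> i'"
  hence "i + 1 \<le> i' \<or> i' + 1 \<le> i" by linarith
  thus False using * q_mono[of "i + 1" i'] q_mono[of "i' + 1" i] by auto
qed

lemma pieces_partition: "{1..n} = (\<Union>i\<in>{0..k}. piece i)"
proof
  show "{1..n} \<subseteq> (\<Union>i\<in>{0..k}. piece i)" using piece_exists by fastforce
  show "(\<Union>i\<in>{0..k}. piece i) \<subseteq> {1..n}"
  proof
    fix j assume "j \<in> (\<Union>i\<in>{0..k}. piece i)"
    then obtain i where i: "i \<le> k" "j \<in> piece i" by auto
    thus "j \<in> {1..n}" using q_ge_1[of i] q_le[of "i + 1"] by auto
  qed
qed

lemma piece_subset: "i \<le> k \<Longrightarrow> piece i \<subseteq> {1..n}"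
  unfolding pieces_partition by (rule UN_upper) simp

lemma sum_pieces: 
  fixes f :: "nat \<Rightarrow> real"
  shows "(\<Sum>j=1..n. f j) = (\<Sum>i=0..k. \<Sum>j\<in>piece i. f j)"
  unfolding pieces_partition
proof (rule sum.UNION_disjoint)
  show "\<forall>i\<in>{0..k}. \<forall>j\<in>{0..k}. i \<noteq> j \<longrightarrow> piece i \<inter> piece j = {}"
  proof (intro ballI impI)
    fix i j assume "i \<in> {0..k}" "j \<in> {0..k}" "i \<noteq> j"
    thus "piece i \<inter> piece j = {}" using piece_unique[of _ i j] by (meson atLeastAtMost_iff disjoint_iff)
  qed
qed simp_all

definition piece_of :: "nat \<Rightarrow> nat" where
  "piece_of j = (SOME i. i \<le> k \<and> j \<in> piece i)"

lemma piece_of_eq: "i \<le> k \<Longrightarrow> j \<in> piece i \<Longrightarrow> piece_of j = i"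
  unfolding piece_of_def using piece_unique by (intro some_equality) blast+

text \<open>
  Summation by parts turns the inner product with \<open>v\<close> into a sum of \<open>u\<close> against the differences, which
  is at most the total variation, with equality at \<open>\<theta>\<close>.
\<close>
lemma dual_path_in_subdiff:
  assumes u: "u 1 = 0" "u (n + 1) = 0" "\<And>j. j \<in> {1..n + 1} \<Longrightarrow> \<bar>u j\<bar> \<le> 1"
    and us: "\<And>i. i \<in> {1..k} \<Longrightarrow> u (q i) = s i"
  shows "(\<lambda>j. if j \<in> {1..n} then u j - u (j + 1) else 0) \<in> subdiff n (tv n) \<theta>"
proof -
  define v where "v j = (if j \<in> {1..n} then u j - u (j + 1) else 0)" for j
  have inner: "inner_n n v \<eta> = (\<Sum>i=1..n-1. u (i + 1) * diff_op \<eta> i)" for \<eta>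
  proof -
    have "inner_n n v \<eta> = (\<Sum>j=1..n. (u j - u (j + 1)) * \<eta> j)"
      unfolding inner_n_def v_def by (intro sum.cong) auto
    also have "\<dots> = u 1 * \<eta> 1 - u (n + 1) * \<eta> n + (\<Sum>i=1..n-1. u (i + 1) * (\<eta> (i + 1) - \<eta> i))"
      using n by (intro sum_by_parts) simp
    finally show ?thesis unfolding u(1,2) diff_op_def by simp
  qed
  have le: "inner_n n v \<eta> \<le> tv n \<eta>" for \<eta>
    unfolding inner tv_def
  proof (rule sum_mono)
    fix i assume "i \<in> {1..n-1}"
    hence "\<bar>u (i + 1)\<bar> \<le> 1" using n by (intro u) auto
    hence "\<bar>u (i + 1)\<bar> * \<bar>diff_op \<eta> i\<bar> \<le> 1 * \<bar>diff_op \<eta> i\<bar>" by (rule mult_right_mono) simp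
    thus "u (i + 1) * diff_op \<eta> i \<le> \<bar>diff_op \<eta> i\<bar>"
      using abs_ge_self[of "u (i + 1) * diff_op \<eta> i"] unfolding abs_mult by linarith
  qed
  have eq: "inner_n n v \<theta> = tv n \<theta>"
    unfolding inner tv_def
  proof (rule sum.cong[OF refl])
    fix i assume i: "i \<in> {1..n-1}"
    show "u (i + 1) * diff_op \<theta> i = \<bar>diff_op \<theta> i\<bar>"
    proof (cases "diff_op \<theta> i = 0")
      case False
      hence "i + 1 \<in> jumps n \<theta>" using i n by (auto simp: jumps_def diff_op_def)
      then obtain l where l: "l \<in> {1..k}" "q l = i + 1" using jump_surj q_jump by metis
      have "u (i + 1) = sgn (diff_op \<theta> i)" using us[OF l(1)] sign_jump[OF l(1)] l(2) by (simp add: diff_op_def)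
      thus ?thesis by (simp add: sgn_mult_self_eq mult.commute[of "sgn _"] linordered_idom_class.abs_sgn[symmetric])
    qed simp
  qed
  have sub: "inner_n n v (\<eta> - \<theta>) = inner_n n v \<eta> - inner_n n v \<theta>" for \<eta>
    by (simp add: inner_n_def right_diff_distrib sum_subtractf)
  have "v \<in> Rn n" by (auto simp: Rn_def v_def)
  moreover have "tv n \<eta> \<ge> tv n \<theta> + inner_n n v (\<eta> - \<theta>)" for \<eta>
    using le[of \<eta>] eq unfolding sub by simp
  ultimately have "v \<in> subdiff n (tv n) \<theta>" unfolding subdiff_def by blast
  thus ?thesis unfolding v_def .
qed

definition tail_sum :: "(nat \<Rightarrow> real) \<Rightarrow> nat \<Rightarrow> real" where
  "tail_sum v j = (\<Sum>l=j..n. v l)"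

text \<open>
  Tail sums recover the dual path of a subgradient: shifting \<open>\<theta>\<close> by \<open>\<epsilon>\<close> on \<open>{j..n}\<close> changes the total
  variation in the difference at \<open>j\<close> alone.
\<close>
lemma subgradient_tail_sum:
  assumes v: "v \<in> subdiff n (tv n) \<theta>" and j: "j \<in> {1..n}"
  shows "\<epsilon> * tail_sum v j \<le> (if j = 1 then 0 else \<bar>\<theta> j - \<theta> (j - 1) + \<epsilon>\<bar> - \<bar>\<theta> j - \<theta> (j - 1)\<bar>)"
proof -
  define e where "e l = (if l \<in> {j..n} then \<epsilon> else 0)" for l
  define \<eta> where "\<eta> = \<theta> + e"
  have "\<eta> \<in> Rn n" using \<theta> j unfolding Rn_def \<eta>_def e_def by (auto simp: plus_fun_def)
  hence "tv n \<eta> \<ge> tv n \<theta> + inner_n n v (\<eta> - \<theta>)" using v unfolding subdiff_def by blast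
  moreover have "inner_n n v (\<eta> - \<theta>) = \<epsilon> * tail_sum v j"
  proof -
    have "inner_n n v (\<eta> - \<theta>) = (\<Sum>l=1..n. v l * e l)" by (simp add: inner_n_def \<eta>_def)
    also have "\<dots> = (\<Sum>l=j..n. v l * \<epsilon>)"
      using j by (intro sum.mono_neutral_cong_right) (auto simp: e_def)
    finally show ?thesis by (simp add: tail_sum_def sum_distrib_left mult.commute)
  qed
  moreover have "tv n \<eta> - tv n \<theta> = (if j = 1 then 0 else \<bar>\<theta> j - \<theta> (j - 1) + \<epsilon>\<bar> - \<bar>\<theta> j - \<theta> (j - 1)\<bar>)"
  proof -
    have "tv n \<eta> - tv n \<theta> = (\<Sum>i=1..n-1. \<bar>diff_op \<eta> i\<bar> - \<bar>diff_op \<theta> i\<bar>)"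
      by (simp add: tv_def sum_subtractf)
    also have "\<dots> = (\<Sum>i=1..n-1. if i = j - 1 then \<bar>\<theta> j - \<theta> (j - 1) + \<epsilon>\<bar> - \<bar>\<theta> j - \<theta> (j - 1)\<bar> else 0)"
      using j n by (intro sum.cong refl) (auto simp: diff_op_def \<eta>_def e_def algebra_simps)
    also have "\<dots> = (if j = 1 then 0 else \<bar>\<theta> j - \<theta> (j - 1) + \<epsilon>\<bar> - \<bar>\<theta> j - \<theta> (j - 1)\<bar>)"
      using j by auto
    finally show ?thesis .
  qed
  ultimately show ?thesis by linarith
qed

lemma tail_sum_1: "v \<in> subdiff n (tv n) \<theta> \<Longrightarrow> tail_sum v 1 = 0"
  using subgradient_tail_sum[of v 1 1] subgradient_tail_sum[of v 1 "-1"] n by simp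

lemma abs_tail_sum_le: 
  assumes v: "v \<in> subdiff n (tv n) \<theta>" and j: "j \<in> {1..n}"
  shows "\<bar>tail_sum v j\<bar> \<le> 1"
  using subgradient_tail_sum[OF v j, of 1] subgradient_tail_sum[OF v j, of "-1"] by (auto split: if_splits)

lemma tail_sum_jump:
  assumes v: "v \<in> subdiff n (tv n) \<theta>" and i: "i \<in> {1..k}"
  shows "tail_sum v (q i) = s i"
proof -
  have j: "q i \<in> {2..n}" and ne: "\<theta> (q i - 1) \<noteq> \<theta> (q i)" 
    using jump_in[OF i] q_jump[OF i] by (auto simp: jumps_def)
  define d where "d = \<theta> (q i) - \<theta> (q i - 1)"
  have d: "d \<noteq> 0" using ne unfolding d_def by simp
  have "d * tail_sum v (q i) \<le> \<bar>d + d\<bar> - \<bar>d\<bar>" "- d * tail_sum v (q i) \<le> \<bar>d - d\<bar> - \<bar>d\<bar>"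
    using subgradient_tail_sum[OF v, of "q i" d] subgradient_tail_sum[OF v, of "q i" "- d"] j
    by (auto simp: d_def)
  hence "d * tail_sum v (q i) = \<bar>d\<bar>" by simp
  hence "d * tail_sum v (q i) = d * sgn d" by (simp add: abs_sgn)
  thus ?thesis using d sign_jump[OF i] by (simp add: d_def)
qed

lemma subdiff_piece_sum:
  assumes v: "v \<in> subdiff n (tv n) \<theta>" and i: "i \<le> k"
  shows "(\<Sum>j\<in>piece i. v j) = s i - s (i + 1)"
proof -
  have t: "tail_sum v (q i) = s i" if i_le: "i \<le> Suc k" for i
  proof -
    consider "i = 0" | "i = Suc k" | "i \<in> {1..k}"
      using i_le by fastforce
    thus ?thesis
    proof cases
      case 1 thus ?thesis using tail_sum_1[OF v] by (simp add: sign_boundary)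
    next
      case 2 thus ?thesis by (simp add: tail_sum_def sign_boundary)
    next
      case 3 thus ?thesis by (rule tail_sum_jump[OF v])
    qed
  qed
  have ts: "tail_sum v j = sum v {j..<n + 1}" for j
    unfolding tail_sum_def by (intro sum.cong) auto
  have "sum v (piece i) + sum v {q (i + 1)..<n + 1} = sum v {q i..<n + 1}"
    using q_less[OF i] q_le[of "i + 1"] i by (intro sum.atLeastLessThan_concat) auto
  thus ?thesis using t[of i] t[of "i + 1"] i unfolding ts by simp
qed

lemma affine_hull_piece_sum:
  assumes v: "v \<in> affine hull (subdiff n (tv n) \<theta>)" and i: "i \<le> k"
  shows "(\<Sum>j\<in>piece i. v j) = s i - s (i + 1)"
proof -
  let ?A = "{v :: nat \<Rightarrow> real. (\<Sum>j\<in>piece i. v j) = s i - s (i + 1)}"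
  have "affine ?A"
    unfolding affine_def
  proof (intro ballI allI impI)
    fix x y :: "nat \<Rightarrow> real" and a b :: real
    assume xy: "x \<in> ?A" "y \<in> ?A" and ab: "a + b = 1"
    have "(\<Sum>j\<in>piece i. (a *\<^sub>R x + b *\<^sub>R y) j) = a * (\<Sum>j\<in>piece i. x j) + b * (\<Sum>j\<in>piece i. y j)"
      by (simp add: scaleR_fun_def sum.distrib sum_distrib_left)
    also have "\<dots> = (a + b) * (s i - s (i + 1))" using xy by (simp add: distrib_right)
    finally show "a *\<^sub>R x + b *\<^sub>R y \<in> ?A" using ab by simp
  qed
  moreover have "subdiff n (tv n) \<theta> \<subseteq> ?A" using subdiff_piece_sum[OF _ i] by blast
  ultimately have "affine hull (subdiff n (tv n) \<theta>) \<subseteq> ?A" by (intro hull_minimal)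
  thus ?thesis using v by blast
qed

text \<open>
  The squared norm of \<open>v0\<close>: among all vectors with the given piece sums, the piecewise constant one is
  the shortest.
\<close>
definition min_energy :: real where
  "min_energy = (\<Sum>i=0..k. (s i - s (i + 1))^2 / real (q (i + 1) - q i))"

lemma norm_n_square: "(norm_n n v)^2 = (\<Sum>j=1..n. (v j)^2)"
  unfolding norm_n_def L2_set_def by (simp add: sum_nonneg)

lemma norm_n_nonneg: "0 \<le> norm_n n v"
  by (simp add: norm_n_def)

lemma min_energy_le:
  assumes v: "v \<in> affine hull (subdiff n (tv n) \<theta>)"
  shows "min_energy \<le> (norm_n n v)^2"
proof -
  have "(s i - s (i + 1))^2 / real (q (i + 1) - q i) \<le> (\<Sum>j\<in>piece i. (v j)^2)" if "i \<in> {0..k}" for i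
  proof -
    have i: "i \<le> k" using that by simp
    have "(s i - s (i + 1))^2 = (\<Sum>j\<in>piece i. 1 * v j)^2" 
      using affine_hull_piece_sum[OF v i] by simp
    also have "\<dots> \<le> (\<Sum>j\<in>piece i. 1^2) * (\<Sum>j\<in>piece i. (v j)^2)" by (rule Cauchy_Schwarz_ineq_sum)
    also have "\<dots> = real (q (i + 1) - q i) * (\<Sum>j\<in>piece i. (v j)^2)" by simp
    finally show ?thesis using q_less[OF i] by (simp add: divide_le_eq mult.commute)
  qed
  thus ?thesis unfolding norm_n_square sum_pieces min_energy_def by (intro sum_mono)
qed

definition flat_subgradient :: "nat \<Rightarrow> real" where
  "flat_subgradient j = (if j \<in> {1..n} then 
     (s (piece_of j) - s (piece_of j + 1)) / real (q (piece_of j + 1) - q (piece_of j)) else 0)"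

text \<open>
  Its dual path interpolates linearly between the values \<open>s i\<close> at the points \<open>q i\<close>, so it stays in
  \<open>[-1, 1]\<close>.
\<close>
lemma flat_subgradient_in: "flat_subgradient \<in> subdiff n (tv n) \<theta>"
proof -
  define u where "u j = (if j \<in> {1..n} then s (piece_of j) + real (j - q (piece_of j)) / 
     real (q (piece_of j + 1) - q (piece_of j)) * (s (piece_of j + 1) - s (piece_of j)) else 0)" for j
  have u: "u j = s i + real (j - q i) / real (q (i + 1) - q i) * (s (i + 1) - s i)" 
    if i: "i \<le> k" and j: "j \<in> {q i..q (i + 1)}" for i j
  proof (cases "j = q (i + 1)")
    case False
    hence "j \<in> piece i" using j by auto
    thus ?thesis using piece_of_eq[OF i] piece_subset[OF i] unfolding u_def by auto
  next
    case True
    have rhs: "s i + real (j - q i) / real (q (i + 1) - q i) * (s (i + 1) - s i) = s (i + 1)"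
      using True q_less[OF i] by simp
    show ?thesis
    proof (cases "i = k")
      case True
      hence "j = n + 1" using \<open>j = q (i + 1)\<close> by simp
      thus ?thesis unfolding rhs using True by (simp add: u_def sign_boundary)
    next
      case False
      hence i1: "i + 1 \<le> k" using i by simp
      have "j \<in> piece (i + 1)" using True q_less[OF i1] by simp
      hence "piece_of j = i + 1" "j \<in> {1..n}" using piece_of_eq[OF i1] piece_subset[OF i1] by auto
      thus ?thesis unfolding rhs u_def using True by simp
    qed
  qed
  have at_q: "u (q i) = s i" if "i \<le> k" for i
    using u[OF that, of "q i"] q_less[OF that] by simp
  have u_le: "\<bar>u j\<bar> \<le> 1" if j: "j \<in> {1..n + 1}" for j
  proof (cases "j = n + 1")
    case False
    then obtain i where i: "i \<le> k" "j \<in> piece i" using piece_exists[of j] j by auto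
    define t where "t = real (j - q i) / real (q (i + 1) - q i)"
    have t: "0 \<le> t" "t \<le> 1" using i q_less[OF i(1)] unfolding t_def by auto
    have "u j = (1 - t) * s i + t * s (i + 1)"
      using u[OF i(1), of j] i(2) unfolding t_def[symmetric] by (simp add: algebra_simps)
    also have "\<bar>\<dots>\<bar> \<le> (1 - t) * \<bar>s i\<bar> + t * \<bar>s (i + 1)\<bar>"
      using t abs_triangle_ineq[of "(1 - t) * s i" "t * s (i + 1)"] by (simp add: abs_mult)
    also have "\<dots> \<le> (1 - t) * 1 + t * 1"
      using t sign_values[of i] sign_values[of "i + 1"] by (intro add_mono mult_left_mono) auto
    finally show ?thesis by simp
  qed (simp add: u_def)
  have "(\<lambda>j. if j \<in> {1..n} then u j - u (j + 1) else 0) \<in> subdiff n (tv n) \<theta>"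
    using at_q[of 0] at_q u_le by (intro dual_path_in_subdiff) (auto simp: sign_boundary u_def)
  also have "(\<lambda>j. if j \<in> {1..n} then u j - u (j + 1) else 0) = flat_subgradient"
  proof
    fix j
    show "(if j \<in> {1..n} then u j - u (j + 1) else 0) = flat_subgradient j"
    proof (cases "j \<in> {1..n}")
      case True
      then obtain i where i: "i \<le> k" "j \<in> piece i" using piece_exists[of j] by auto
      define w where "w = real (q (i + 1) - q i)"
      have w: "w > 0" using q_less[OF i(1)] unfolding w_def by simp
      have r: "real (j + 1 - q i) = real (j - q i) + 1" using i by auto
      have "u j - u (j + 1) = real (j - q i) / w * (s (i + 1) - s i) - (real (j - q i) + 1) / w * (s (i + 1) - s i)"
        using u[OF i(1), of j] u[OF i(1), of "j + 1"] i(2) unfolding w_def r by simp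
      also have "\<dots> = (s i - s (i + 1)) / w" using w by (simp add: field_simps)
      finally show ?thesis using True piece_of_eq[OF i] unfolding flat_subgradient_def w_def by simp
    qed (auto simp: flat_subgradient_def)
  qed
  finally show ?thesis .
qed

lemma norm_flat_subgradient: "(norm_n n flat_subgradient)^2 = min_energy"
  unfolding norm_n_square sum_pieces min_energy_def
proof (rule sum.cong[OF refl])
  fix i assume "i \<in> {0..k}"
  hence i: "i \<le> k" by simp
  define w where "w = real (q (i + 1) - q i)"
  have w: "w > 0" using q_less[OF i] unfolding w_def by simp
  have "(\<Sum>j\<in>piece i. (flat_subgradient j)^2) = (\<Sum>j\<in>piece i. ((s i - s (i + 1)) / w)^2)"
  proof (rule sum.cong[OF refl])
    fix j assume j: "j \<in> piece i"
    hence "j \<in> {1..n}" using piece_subset[OF i] by blast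
    thus "(flat_subgradient j)^2 = ((s i - s (i + 1)) / w)^2"
      unfolding flat_subgradient_def w_def using piece_of_eq[OF i j] by simp
  qed
  also have "\<dots> = w * ((s i - s (i + 1)) / w)^2" unfolding sum_constant by (simp only: card_atLeastLessThan w_def)
  also have "\<dots> = (s i - s (i + 1))^2 / w" using w by (simp add: power2_eq_square)
  finally show "(\<Sum>j\<in>piece i. (flat_subgradient j)^2) = (s i - s (i + 1))^2 / real (q (i + 1) - q i)"
    unfolding w_def .
qed

text \<open>
  The minimum that defines \<open>v0\<close> is attained, because \<open>flat_subgradient\<close> attains it; hence \<open>v0\<close> does
  belong to the affine hull.
\<close>
lemma v0_norm: "min_energy \<le> (norm_n n (v0 n \<theta>))^2"
proof -
  let ?H = "affine hull (subdiff n (tv n) \<theta>)"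
  have min: "norm_n n flat_subgradient \<le> norm_n n y" if "y \<in> ?H" for y
    using min_energy_le[OF that] norm_flat_subgradient by (intro power2_le_imp_le[OF _ norm_n_nonneg]) simp
  have "v0 n \<theta> \<in> ?H"
    unfolding v0_def arg_min_on_def
  proof (rule arg_minI[of _ flat_subgradient])
    show "flat_subgradient \<in> ?H" using flat_subgradient_in by (rule hull_inc)
    show "\<not> norm_n n y < norm_n n flat_subgradient" if "y \<in> ?H" for y using min[OF that] by simp
  qed
  thus ?thesis by (rule min_energy_le)
qed

lemma subdiff_norm_le:
  assumes v: "v \<in> subdiff n (tv n) \<theta>"
  shows "norm_n n v \<le> 2 * real n"
proof -
  have "\<bar>v j\<bar> \<le> 2" if j: "j \<in> {1..n}" for j
  proof -
    have "tail_sum v j = v j + tail_sum v (j + 1)"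
      using j unfolding tail_sum_def by (simp add: sum.atLeast_Suc_atMost)
    moreover have "\<bar>tail_sum v (j + 1)\<bar> \<le> 1"
      using abs_tail_sum_le[OF v, of "j + 1"] j by (cases "j = n") (auto simp: tail_sum_def)
    ultimately show ?thesis using abs_tail_sum_le[OF v j] by linarith
  qed
  hence "(\<Sum>j\<in>{1..n}. \<bar>v j\<bar>) \<le> (\<Sum>j\<in>{1..n}. 2)" by (rule sum_mono)
  thus ?thesis unfolding norm_n_def using L2_set_le_sum_abs[of v "{1..n}"] by simp
qed

end

section \<open>The minimising multiplier and its expectation\<close>

lemma norm_n_triangle: "norm_n n (\<lambda>i. x i + y i) \<le> norm_n n x + norm_n n y"
  unfolding norm_n_def by (rule L2_set_triangle_ineq)

lemma norm_n_scale: "norm_n n (\<lambda>i. c * x i) = \<bar>c\<bar> * norm_n n x"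
proof -
  have "norm_n n (\<lambda>i. c * x i) = norm_n n (\<lambda>i. \<bar>c\<bar> * x i)"
    unfolding norm_n_def L2_set_def by (simp add: power_mult_distrib)
  also have "\<dots> = \<bar>c\<bar> * norm_n n x"
    unfolding norm_n_def by (rule L2_set_right_distrib[symmetric]) simp
  finally show ?thesis .
qed

lemma abs_sum_le_norm_n:
  assumes "I \<subseteq> {1..n}"
  shows "\<bar>\<Sum>j\<in>I. x j\<bar> \<le> sqrt (real (card I)) * norm_n n x"
proof -
  have "(\<Sum>j\<in>I. x j)^2 = (\<Sum>j\<in>I. 1 * x j)^2" by simp
  also have "\<dots> \<le> (\<Sum>j\<in>I. 1^2) * (\<Sum>j\<in>I. (x j)^2)" by (rule Cauchy_Schwarz_ineq_sum)
  also have "\<dots> \<le> real (card I) * (\<Sum>j=1..n. (x j)^2)"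
    using assms by (simp, intro mult_left_mono sum_mono2) auto
  finally have "sqrt ((\<Sum>j\<in>I. x j)^2) \<le> sqrt (real (card I) * (\<Sum>j=1..n. (x j)^2))" by (rule real_sqrt_le_mono)
  thus ?thesis by (simp add: real_sqrt_mult norm_n_def L2_set_def)
qed

text \<open>
  Bounds the mean of \<open>x\<close> by its second moment; with \<open>c\<close> the root mean square of \<open>x\<close> this is as good as
  Cauchy-Schwarz, and the right-hand side is integrable whenever \<open>x\<^sup>2\<close> is.
\<close>
lemma le_of_square_mean: "0 < c \<Longrightarrow> (x::real) \<le> (x^2 / c + c) / 2"
proof -
  assume c: "0 < c"
  have "0 \<le> (x - c)^2 / c" using c by simp
  also have "\<dots> = x^2 / c + c - 2 * x" using c by (simp add: power2_eq_square field_simps)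
  finally show ?thesis by simp
qed

context signal begin

abbreviation subgradients :: "(nat \<Rightarrow> real) set" where "subgradients \<equiv> subdiff n (tv n) \<theta>"

definition changes :: "nat set" where "changes = {i \<in> {0..k}. s i \<noteq> s (i + 1)}"

lemma changes_eq: "changes = sign_changes n \<theta>"
  by (auto simp: changes_def sign_changes_def)

lemma finite_changes: "finite changes"
  by (simp add: changes_def)

lemma zero_in_changes: "0 \<in> changes"
  using sign_nonzero[of 1] sign_boundary(1) has_jump by (simp add: changes_def)

lemma card_changes: "1 \<le> card changes" "card changes \<le> k + 1"
proof -
  show "1 \<le> card changes" using zero_in_changes finite_changes by (simp add: Suc_le_eq card_gt_0_iff) blast
  have "card changes \<le> card {0..k}" unfolding changes_def by (intro card_mono) auto
  thus "card changes \<le> k + 1" by simp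
qed

lemma sign_gap_ge_1: "i \<in> changes \<Longrightarrow> 1 \<le> \<bar>s i - s (i + 1)\<bar>"
proof -
  assume "i \<in> changes"
  hence "jump_sign n \<theta> i \<noteq> jump_sign n \<theta> (i + 1)" by (auto simp: changes_def)
  hence "1 \<le> \<bar>jump_sign n \<theta> i - jump_sign n \<theta> (i + 1)\<bar>" by linarith
  hence "real_of_int 1 \<le> real_of_int \<bar>jump_sign n \<theta> i - jump_sign n \<theta> (i + 1)\<bar>"
    by (simp only: of_int_le_iff)
  thus ?thesis by simp
qed

lemma min_energy_pos: "0 < min_energy"
proof -
  have "0 < (s 0 - s (0 + 1))^2 / real (q (0 + 1) - q 0)"
    using sign_gap_ge_1[OF zero_in_changes] q_less[of 0] by (intro divide_pos_pos) auto
  also have "\<dots> \<le> min_energy" unfolding min_energy_def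
    by (rule member_le_sum) (auto intro: divide_nonneg_nonneg)
  finally show ?thesis .
qed

definition ray_dist :: "(nat \<Rightarrow> real) \<Rightarrow> real \<Rightarrow> real" where
  "ray_dist z l = (INF v\<in>subgradients. norm_n n (z - l *\<^sub>R v))"

lemma subgradients_nonempty: "subgradients \<noteq> {}"
  using flat_subgradient_in by blast

lemma bdd_below_dist: "bdd_below ((\<lambda>v. norm_n n (z - l *\<^sub>R v)) ` subgradients)"
  by (intro bdd_belowI[of _ 0]) (auto simp: norm_n_nonneg)

lemma ray_dist_le: "v \<in> subgradients \<Longrightarrow> ray_dist z l \<le> norm_n n (z - l *\<^sub>R v)"
  unfolding ray_dist_def by (rule cINF_lower[OF bdd_below_dist])

lemma ray_dist_greatest:
  "(\<And>v. v \<in> subgradients \<Longrightarrow> c \<le> norm_n n (z - l *\<^sub>R v)) \<Longrightarrow> c \<le> ray_dist z l"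
  unfolding ray_dist_def by (rule cINF_greatest[OF subgradients_nonempty])

lemma ray_dist_lipschitz: "ray_dist z l \<le> ray_dist z l' + \<bar>l - l'\<bar> * (2 * real n)"
proof -
  have "ray_dist z l - \<bar>l - l'\<bar> * (2 * real n) \<le> ray_dist z l'"
  proof (rule ray_dist_greatest)
    fix v assume v: "v \<in> subgradients"
    have "ray_dist z l \<le> norm_n n (z - l *\<^sub>R v)" by (rule ray_dist_le[OF v])
    also have "z - l *\<^sub>R v = (\<lambda>i. (z - l' *\<^sub>R v) i + (l' - l) * v i)"
      by (simp add: fun_eq_iff scaleR_fun_def algebra_simps)
    also have "norm_n n \<dots> \<le> norm_n n (z - l' *\<^sub>R v) + \<bar>l' - l\<bar> * norm_n n v"
      using norm_n_triangle[of n "z - l' *\<^sub>R v" "\<lambda>i. (l' - l) * v i"] by (simp add: norm_n_scale)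
    finally have "ray_dist z l \<le> norm_n n (z - l' *\<^sub>R v) + \<bar>l' - l\<bar> * norm_n n v" .
    moreover have "\<bar>l' - l\<bar> * norm_n n v \<le> \<bar>l' - l\<bar> * (2 * real n)"
      by (intro mult_left_mono subdiff_norm_le[OF v]) simp
    ultimately show "ray_dist z l - \<bar>l - l'\<bar> * (2 * real n) \<le> norm_n n (z - l' *\<^sub>R v)"
      unfolding abs_minus_commute[of l l'] by linarith
  qed
  thus ?thesis by simp
qed

lemma continuous_ray_dist: "continuous_on S (ray_dist z)"
proof -
  have "(2 * real n)-lipschitz_on S (ray_dist z)"
  proof (rule lipschitz_onI)
    fix x y
    show "dist (ray_dist z x) (ray_dist z y) \<le> 2 * real n * dist x y"
      using ray_dist_lipschitz[of z x y] ray_dist_lipschitz[of z y x]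
      by (simp add: dist_real_def abs_minus_commute mult.commute abs_le_iff)
  qed simp
  thus ?thesis by (rule lipschitz_on_continuous_on)
qed

lemma ray_dist_coercive:
  assumes l: "0 \<le> l"
  shows "l * sqrt min_energy - norm_n n z \<le> ray_dist z l"
proof (rule ray_dist_greatest)
  fix v assume v: "v \<in> subgradients"
  have "sqrt min_energy \<le> norm_n n v"
    using min_energy_le[OF hull_inc[OF v]] by (intro real_le_lsqrt norm_n_nonneg)
  hence "l * sqrt min_energy \<le> l * norm_n n v" using l by (rule mult_left_mono)
  also have "\<dots> = norm_n n (\<lambda>i. l * v i)" using l by (simp add: norm_n_scale)
  also have "(\<lambda>i. l * v i) = (\<lambda>i. z i + (-1) * (z - l *\<^sub>R v) i)"
    by (simp add: fun_eq_iff scaleR_fun_def)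
  also have "norm_n n \<dots> \<le> norm_n n z + norm_n n (z - l *\<^sub>R v)"
  proof -
    have "norm_n n (\<lambda>i. (-1) * (z - l *\<^sub>R v) i) = norm_n n (z - l *\<^sub>R v)"
      by (subst norm_n_scale) simp
    thus ?thesis using norm_n_triangle[of n z "\<lambda>i. (-1) * (z - l *\<^sub>R v) i"] by (simp only:)
  qed
  finally show "l * sqrt min_energy - norm_n n z \<le> norm_n n (z - l *\<^sub>R v)" by linarith
qed

text \<open>
  The minimum exists: \<open>ray_dist z\<close> is continuous, and beyond \<open>K\<close> it is not below its value at \<open>0\<close>
  because subgradients are bounded away from \<open>0\<close>.
\<close>
lemma lambda_fun_minimal:
  "0 \<le> lambda_fun n \<theta> z" "0 \<le> l \<Longrightarrow> ray_dist z (lambda_fun n \<theta> z) \<le> ray_dist z l"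
proof -
  define K where "K = 2 * norm_n n z / sqrt min_energy"
  have K: "0 \<le> K" using norm_n_nonneg min_energy_pos by (simp add: K_def)
  obtain m where m: "m \<in> {0..K}" "\<And>y. y \<in> {0..K} \<Longrightarrow> ray_dist z m \<le> ray_dist z y"
    using continuous_attains_inf[OF _ _ continuous_ray_dist, of "{0..K}" z] K by auto
  have min: "ray_dist z m \<le> ray_dist z y" if "0 \<le> y" for y
  proof (cases "y \<le> K")
    case False
    have "ray_dist z m \<le> ray_dist z 0" using m K by simp
    also have "\<dots> \<le> norm_n n z" using ray_dist_le[OF flat_subgradient_in, of z 0]
      by (simp add: scaleR_fun_def zero_fun_def[symmetric])
    also have "\<dots> = K * sqrt min_energy - norm_n n z" using min_energy_pos by (simp add: K_def)
    also have "\<dots> \<le> y * sqrt min_energy - norm_n n z" 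
      using False min_energy_pos by (simp add: mult_right_mono)
    also have "\<dots> \<le> ray_dist z y" by (rule ray_dist_coercive[OF that])
    finally show ?thesis .
  qed (use m that in auto)
  have "0 \<le> lambda_fun n \<theta> z \<and> (\<forall>l\<ge>0. ray_dist z (lambda_fun n \<theta> z) \<le> ray_dist z l)"
    unfolding lambda_fun_def arg_min_on_def ray_dist_def[symmetric]
  proof (rule arg_minI[of _ m])
    show "m \<in> {0..}" using m by simp
    show "\<not> ray_dist z y < ray_dist z m" if "y \<in> {0..}" for y using min that by force
    show "0 \<le> x \<and> (\<forall>l\<ge>0. ray_dist z x \<le> ray_dist z l)"
      if "x \<in> {0..}" "\<forall>y. y \<in> {0..} \<longrightarrow> \<not> ray_dist z y < ray_dist z x" for x
      using that by (auto simp: not_less)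
  qed
  thus "0 \<le> lambda_fun n \<theta> z" "0 \<le> l \<Longrightarrow> ray_dist z (lambda_fun n \<theta> z) \<le> ray_dist z l" by auto
qed

lemma card_change_pieces:
  assumes X: "\<And>i. i \<in> changes \<Longrightarrow> real (q (i + 1) - q i) \<le> X"
  shows "real (card (\<Union>i\<in>changes. piece i)) \<le> real (card changes) * X"
proof -
  have "real (card (\<Union>i\<in>changes. piece i)) \<le> real (\<Sum>i\<in>changes. card (piece i))"
    using card_UN_le[OF finite_changes, of piece] by (simp only: of_nat_le_iff)
  also have "\<dots> = (\<Sum>i\<in>changes. real (q (i + 1) - q i))" by simp
  also have "\<dots> \<le> (\<Sum>i\<in>changes. X)" by (intro sum_mono X)
  finally show ?thesis by simp
qed

text \<open>
  On a piece \<open>i\<close> where the sign changes, \<open>\<mu> v\<close> has sum \<open>\<mu> (s i - s (i + 1))\<close>, of absolute value at least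
  \<open>\<mu>\<close>.  If it is close to \<open>z\<close> then \<open>\<mu>\<close> cannot exceed the piece sum of \<open>z\<close> by much; adding over these
  pieces and applying Cauchy-Schwarz to their union gives the bound.
\<close>
lemma lambda_fun_le:
  assumes X: "\<And>i. i \<in> changes \<Longrightarrow> real (q (i + 1) - q i) \<le> X" and l: "0 \<le> l"
  shows "real (card changes) * lambda_fun n \<theta> z \<le> 
     (\<Sum>i\<in>changes. \<bar>\<Sum>j\<in>piece i. z j\<bar>) + sqrt (real (card changes) * X) * ray_dist z l"
proof -
  define \<mu> where "\<mu> = lambda_fun n \<theta> z"
  have \<mu>: "0 \<le> \<mu>" "ray_dist z \<mu> \<le> ray_dist z l" using lambda_fun_minimal l unfolding \<mu>_def by auto
  define A where "A = (\<Sum>i\<in>changes. \<bar>\<Sum>j\<in>piece i. z j\<bar>)"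
  define U where "U = (\<Union>i\<in>changes. piece i)"
  define R where "R = sqrt (real (card changes) * X)"
  have X0: "0 < X" using X[OF zero_in_changes] q_less[of 0] by simp
  have R: "0 < R" unfolding R_def using X0 card_changes(1) by simp
  have UR: "sqrt (real (card U)) \<le> R" unfolding U_def R_def
    by (intro real_sqrt_le_mono card_change_pieces X)
  have Un: "U \<subseteq> {1..n}"
    unfolding U_def by (rule UN_least) (rule piece_subset, simp add: changes_def)
  have step: "real (card changes) * \<mu> - A \<le> R * norm_n n (z - \<mu> *\<^sub>R v)" if v: "v \<in> subgradients" for v
  proof -
    define x where "x j = \<bar>(z - \<mu> *\<^sub>R v) j\<bar>" for j
    have "real (card changes) * \<mu> = (\<Sum>i\<in>changes. \<mu> * 1)" by simp
    also have "\<dots> \<le> (\<Sum>i\<in>changes. \<bar>\<Sum>j\<in>piece i. z j\<bar> + (\<Sum>j\<in>piece i. x j))"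
    proof (rule sum_mono)
      fix i assume i: "i \<in> changes"
      hence ik: "i \<le> k" by (simp add: changes_def)
      have "\<mu> * 1 \<le> \<mu> * \<bar>s i - s (i + 1)\<bar>" using sign_gap_ge_1[OF i] \<mu> by (intro mult_left_mono)
      also have "\<dots> = \<bar>\<Sum>j\<in>piece i. \<mu> * v j\<bar>"
        using \<mu> subdiff_piece_sum[OF v ik] by (simp add: abs_mult sum_distrib_left[symmetric])
      also have "(\<Sum>j\<in>piece i. \<mu> * v j) = (\<Sum>j\<in>piece i. z j) - (\<Sum>j\<in>piece i. (z - \<mu> *\<^sub>R v) j)"
        by (simp add: scaleR_fun_def sum_subtractf)
      also have "\<bar>\<dots>\<bar> \<le> \<bar>\<Sum>j\<in>piece i. z j\<bar> + \<bar>\<Sum>j\<in>piece i. (z - \<mu> *\<^sub>R v) j\<bar>" by (rule abs_triangle_ineq4)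
      also have "\<bar>\<Sum>j\<in>piece i. (z - \<mu> *\<^sub>R v) j\<bar> \<le> (\<Sum>j\<in>piece i. x j)" unfolding x_def by (rule sum_abs)
      finally show "\<mu> * 1 \<le> \<bar>\<Sum>j\<in>piece i. z j\<bar> + (\<Sum>j\<in>piece i. x j)" by simp
    qed
    also have "\<dots> = A + (\<Sum>i\<in>changes. \<Sum>j\<in>piece i. x j)" by (simp add: A_def sum.distrib)
    also have "(\<Sum>i\<in>changes. \<Sum>j\<in>piece i. x j) = (\<Sum>j\<in>U. x j)"
      unfolding U_def
    proof (rule sum.UNION_disjoint[symmetric, OF finite_changes])
      show "\<forall>i\<in>changes. \<forall>j\<in>changes. i \<noteq> j \<longrightarrow> piece i \<inter> piece j = {}"
      proof (intro ballI impI)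
        fix i j assume "i \<in> changes" "j \<in> changes" "i \<noteq> j"
        hence "i \<le> k" "j \<le> k" "i \<noteq> j" by (simp_all add: changes_def)
        thus "piece i \<inter> piece j = {}" using piece_unique[of _ i j] by (meson disjoint_iff)
      qed
    qed simp
    also have "(\<Sum>j\<in>U. x j) \<le> sqrt (real (card U)) * norm_n n x"
      using abs_sum_le_norm_n[OF Un, of x] abs_ge_self[of "\<Sum>j\<in>U. x j"] by linarith
    also have "norm_n n x = norm_n n (z - \<mu> *\<^sub>R v)"
      unfolding norm_n_def L2_set_def x_def by simp
    also have "sqrt (real (card U)) * norm_n n (z - \<mu> *\<^sub>R v) \<le> R * norm_n n (z - \<mu> *\<^sub>R v)"
      by (rule mult_right_mono[OF UR norm_n_nonneg])
    finally show ?thesis by simp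
  qed
  have "(real (card changes) * \<mu> - A) / R \<le> ray_dist z \<mu>"
  proof (rule ray_dist_greatest)
    fix v assume "v \<in> subgradients"
    from step[OF this] show "(real (card changes) * \<mu> - A) / R \<le> norm_n n (z - \<mu> *\<^sub>R v)"
      unfolding pos_divide_le_eq[OF R] by (simp only: mult.commute)
  qed
  also have "\<dots> \<le> ray_dist z l" by (rule \<mu>(2))
  finally have "real (card changes) * \<mu> - A \<le> R * ray_dist z l"
    unfolding pos_divide_le_eq[OF R] by (simp only: mult.commute)
  thus ?thesis unfolding A_def \<mu>_def R_def by linarith
qed

lemma piece_sum_square:
  assumes i: "i \<le> k"
  shows "integrable (std_gauss n) (\<lambda>z. (\<Sum>j\<in>piece i. z j)^2)"
    and "(\<integral>z. (\<Sum>j\<in>piece i. z j)^2 \<partial>std_gauss n) = real (q (i + 1) - q i)"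
proof -
  define p where "p = q (i + 1) - q i"
  have qp: "q (i + 1) = q i + p" using q_less[OF i] unfolding p_def by simp
  interpret coordinate_walk n p "\<lambda>l. q i + l - 1" 1
    using q_ge_1[of i] q_le[of "i + 1"] i qp by unfold_locales (auto simp: inj_on_def)
  have eq: "(\<Sum>j\<in>piece i. z j) = partial_sum (walk z) p" for z
    unfolding partial_sum_def qp
  proof (rule sum.reindex_bij_witness[of _ "\<lambda>l. q i + l - 1" "\<lambda>j. j + 1 - q i"])
    fix j assume "j \<in> {q i..<q i + p}"
    hence "q i + (j + 1 - q i) - 1 = j" by auto
    thus "1 * z (q i + (j + 1 - q i) - 1) = z j" by simp
  qed auto
  show "integrable (std_gauss n) (\<lambda>z. (\<Sum>j\<in>piece i. z j)^2)"
    unfolding eq by (rule integrable_partial_sum) simp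
  show "(\<integral>z. (\<Sum>j\<in>piece i. z j)^2 \<partial>std_gauss n) = real (q (i + 1) - q i)"
    unfolding eq p_def[symmetric] by (rule partial_sum_square) simp
qed

text \<open>
  Dividing the tracking path by \<open>height\<close> gives a dual path, so the tracking error bounds the distance to
  \<open>height\<close> times the subdifferential.
\<close>
lemma ray_dist_tracking:
  assumes X: "1 \<le> X" and r: "1 \<le> r"
    and change: "\<And>i. i \<in> changes \<Longrightarrow> real (q (i + 1) - q i) \<le> X \<and> X \<le> r * real (q (i + 1) - q i)"
  shows "\<exists>g l. 0 \<le> l \<and> integrable (std_gauss n) g \<and> 
     (\<integral>z. g z \<partial>std_gauss n) \<le> (real (k + 1) + 2 * real n / X) * (11000 * r * (1 + ln X)) \<and>
     (\<forall>z. (ray_dist z l)^2 \<le> g z)"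
proof -
  interpret tracking_scale X by unfold_locales (rule X)
  have ch: "real (q (Suc i) - q i) \<le> X \<and> X \<le> r * real (q (Suc i) - q i)" if "i < k + 1" "s i \<noteq> s (Suc i)" for i
    using change[of i] that by (simp add: changes_def)
  have "\<exists>g. integrable (std_gauss n) g \<and> 
     (\<integral>z. g z \<partial>std_gauss n) \<le> (real (k + 1) + 2 * real (q (k + 1) - q 0) / X) * (11000 * r * logX) \<and>
     (\<forall>z. \<exists>x. (\<forall>i\<le>k+1. x (q i) = s i * height) \<and> (\<forall>j\<in>{q 0..q (k + 1)}. \<bar>x j\<bar> \<le> height) \<and>
        (\<Sum>j=q 0..<q (k + 1). (z j - (x j - x (j + 1)))^2) \<le> g z)"
  proof (rule bridge_pieces)
    show "s i \<noteq> 0 \<or> s (Suc i) \<noteq> 0" if "i < k + 1" for i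
      using sign_nonzero[of i] sign_nonzero[of 1] has_jump that by (cases "i = 0") auto
  qed (use q_less sign_values r ch in \<open>auto simp del: of_int_eq_iff\<close>)
  then obtain g where g: "integrable (std_gauss n) g"
     "(\<integral>z. g z \<partial>std_gauss n) \<le> (real (k + 1) + 2 * real (q (k + 1) - q 0) / X) * (11000 * r * logX)"
     "\<And>z. \<exists>x. (\<forall>i\<le>k+1. x (q i) = s i * height) \<and> (\<forall>j\<in>{q 0..q (k + 1)}. \<bar>x j\<bar> \<le> height) \<and>
        (\<Sum>j=q 0..<q (k + 1). (z j - (x j - x (j + 1)))^2) \<le> g z"
    by (elim exE conjE) blast
  have "(ray_dist z height)^2 \<le> g z" for z
  proof -
    obtain x where x: "\<forall>i\<le>k+1. x (q i) = s i * height" "\<forall>j\<in>{q 0..q (k + 1)}. \<bar>x j\<bar> \<le> height"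
        "(\<Sum>j=q 0..<q (k + 1). (z j - (x j - x (j + 1)))^2) \<le> g z"
      using g(3)[of z] by (elim exE conjE) blast
    define u where "u j = x j / height" for j
    define v where "v = (\<lambda>j. if j \<in> {1..n} then u j - u (j + 1) else 0)"
    have us: "u (q i) = s i" if "i \<le> k + 1" for i
      using x(1) that height_pos by (simp add: u_def)
    have "v \<in> subgradients"
      unfolding v_def
    proof (rule dual_path_in_subdiff)
      show "u 1 = 0" "u (n + 1) = 0" using us[of 0] us[of "k + 1"] by (simp_all add: sign_boundary)
      show "\<bar>u j\<bar> \<le> 1" if "j \<in> {1..n + 1}" for j
        using x(2) that height_pos by (simp add: u_def abs_divide)
      show "u (q i) = s i" if "i \<in> {1..k}" for i using us[of i] that by simp
    qed
    hence "ray_dist z height \<le> norm_n n (z - height *\<^sub>R v)" by (rule ray_dist_le)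
    moreover have "0 \<le> ray_dist z height" by (rule ray_dist_greatest) (rule norm_n_nonneg)
    ultimately have "(ray_dist z height)^2 \<le> (norm_n n (z - height *\<^sub>R v))^2" by (rule power_mono)
    also have "\<dots> = (\<Sum>j=1..n. (z j - (x j - x (j + 1)))^2)"
      unfolding norm_n_square
    proof (rule sum.cong[OF refl])
      fix j assume "j \<in> {1..n}"
      hence "height * v j = x j - x (j + 1)" using height_pos by (simp add: v_def u_def diff_divide_distrib[symmetric])
      thus "((z - height *\<^sub>R v) j)^2 = (z j - (x j - x (j + 1)))^2" by (simp add: scaleR_fun_def)
    qed
    also have "{1..n} = {q 0..<q (k + 1)}" by auto
    finally show ?thesis using x(3) by simp
  qed
  thus ?thesis using g(1,2) height_pos unfolding logX_def
    by (intro exI[of _ g] exI[of _ height]) (simp add: less_imp_le)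
qed

lemma min_energy_ge:
  assumes X: "\<And>i. i \<in> changes \<Longrightarrow> real (q (i + 1) - q i) \<le> X"
  shows "real (card changes) / X \<le> min_energy"
proof -
  have "real (card changes) / X = (\<Sum>i\<in>changes. 1 / X)" by simp
  also have "\<dots> \<le> (\<Sum>i\<in>changes. (s i - s (i + 1))^2 / real (q (i + 1) - q i))"
  proof (rule sum_mono)
    fix i assume i: "i \<in> changes"
    hence "q i < q (i + 1)" using q_less[of i] by (simp add: changes_def)
    moreover have "1 \<le> (s i - s (i + 1))^2"
      using power_mono[OF sign_gap_ge_1[OF i], of 2] by simp
    ultimately show "1 / X \<le> (s i - s (i + 1))^2 / real (q (i + 1) - q i)"
      using X[OF i] by (intro frac_le) auto
  qed
  also have "\<dots> \<le> min_energy" unfolding min_energy_def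
    by (intro sum_mono2) (auto simp: changes_def)
  finally show ?thesis .
qed

text \<open>
  The expectation of the bound \<open>lambda_fun_le\<close> contributes one \<open>sqrt X\<close> and the square root, and the term
  with \<open>v0\<close> contributes \<open>2 * sqrt X\<close>.
\<close>
lemma lambda_star_le:
  assumes X: "1 \<le> X" and r: "1 \<le> r"
    and change: "\<And>i. i \<in> changes \<Longrightarrow> real (q (i + 1) - q i) \<le> X \<and> X \<le> r * real (q (i + 1) - q i)"
  shows "lambda_star n \<theta> \<le> 3 * sqrt X + 
    sqrt (X / real (card changes) * ((real (k + 1) + 2 * real n / X) * (11000 * r * (1 + ln X))))"
proof -
  interpret prob_space "std_gauss n" by (rule prob_space_std_gauss)
  define m where "m = real (card changes)"
  define E where "E = (real (k + 1) + 2 * real n / X) * (11000 * r * (1 + ln X))"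
  have m: "1 \<le> m" using card_changes(1) unfolding m_def by simp
  have E: "0 < E" unfolding E_def using X r by (intro mult_pos_pos add_pos_nonneg) auto
  have chX: "\<And>i. i \<in> changes \<Longrightarrow> real (q (i + 1) - q i) \<le> X" using change by blast
  obtain g l where g: "0 \<le> l" "integrable (std_gauss n) g" "(\<integral>z. g z \<partial>std_gauss n) \<le> E"
    "\<And>z. (ray_dist z l)^2 \<le> g z"
    using ray_dist_tracking[OF X r change] unfolding E_def by blast
  define G where "G z = ((\<Sum>i\<in>changes. ((\<Sum>j\<in>piece i. z j)^2 / sqrt X + sqrt X) / 2) + 
      sqrt (m * X) * ((g z / sqrt E + sqrt E) / 2)) / m" for z
  have le: "lambda_fun n \<theta> z \<le> G z" for z
  proof -
    have "m * lambda_fun n \<theta> z \<le> (\<Sum>i\<in>changes. \<bar>\<Sum>j\<in>piece i. z j\<bar>) + sqrt (m * X) * ray_dist z l"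
      unfolding m_def by (rule lambda_fun_le[OF chX g(1)])
    also have "\<dots> \<le> (\<Sum>i\<in>changes. ((\<Sum>j\<in>piece i. z j)^2 / sqrt X + sqrt X) / 2) + 
      sqrt (m * X) * ((g z / sqrt E + sqrt E) / 2)"
    proof (intro add_mono sum_mono mult_left_mono)
      show "\<bar>\<Sum>j\<in>piece i. z j\<bar> \<le> ((\<Sum>j\<in>piece i. z j)^2 / sqrt X + sqrt X) / 2" for i
        using le_of_square_mean[of "sqrt X" "\<bar>\<Sum>j\<in>piece i. z j\<bar>"] X by simp
      have "ray_dist z l \<le> ((ray_dist z l)^2 / sqrt E + sqrt E) / 2"
        by (rule le_of_square_mean) (use E in simp)
      also have "\<dots> \<le> (g z / sqrt E + sqrt E) / 2"
        using g(4)[of z] E by (intro divide_right_mono add_right_mono) auto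
      finally show "ray_dist z l \<le> (g z / sqrt E + sqrt E) / 2" .
    qed (use m X in simp)
    finally show ?thesis using m unfolding G_def by (simp add: pos_le_divide_eq mult.commute)
  qed
  have ik: "i \<le> k" if "i \<in> changes" for i using that by (simp add: changes_def)
  note ps = piece_sum_square[OF ik]
  have intG: "integrable (std_gauss n) G"
    unfolding G_def using ps(1) g(2)
    by (intro integrable_divide Bochner_Integration.integrable_add Bochner_Integration.integrable_sum integrable_mult_right) auto
  have G0: "0 \<le> G z" for z using le[of z] lambda_fun_minimal(1)[of z] by linarith
  have "(\<integral>z. G z \<partial>std_gauss n) = ((\<Sum>i\<in>changes. ((\<integral>z. (\<Sum>j\<in>piece i. z j)^2 \<partial>std_gauss n) / sqrt X + sqrt X) / 2) + 
      sqrt (m * X) * (((\<integral>z. g z \<partial>std_gauss n) / sqrt E + sqrt E) / 2)) / m"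
    unfolding G_def using ps(1) g(2)
    by (simp add: Bochner_Integration.integral_sum prob_space)
  also have "\<dots> \<le> ((\<Sum>i\<in>changes. (X / sqrt X + sqrt X) / 2) + sqrt (m * X) * ((E / sqrt E + sqrt E) / 2)) / m"
  proof -
    have "(\<integral>z. (\<Sum>j\<in>piece i. z j)^2 \<partial>std_gauss n) \<le> X" if "i \<in> changes" for i
      using ps(2)[OF that] chX[OF that] by simp
    thus ?thesis using m X E g(3)
      by (intro divide_right_mono add_mono sum_mono mult_left_mono) auto
  qed
  also have "\<dots> = (m * sqrt X + sqrt (m * X) * sqrt E) / m"
    using X E by (simp add: real_div_sqrt m_def)
  also have "\<dots> = sqrt X + sqrt (X / m * E)"
  proof -
    have "sqrt (m * X) * sqrt E = m * sqrt (X / m * E)"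
    proof -
      have "m * sqrt (X / m * E) = sqrt (m^2 * (X / m * E))" using m by (subst real_sqrt_mult[of "m^2"]) simp
      also have "m^2 * (X / m * E) = m * X * E" using m by (simp add: power2_eq_square)
      finally show ?thesis by (simp add: real_sqrt_mult)
    qed
    thus ?thesis using m by (simp add: add_divide_distrib)
  qed
  finally have intle: "(\<integral>z. G z \<partial>std_gauss n) \<le> sqrt X + sqrt (X / m * E)" .
  \<comment> \<open>the integral of a function that is not integrable is 0, which the nonnegative bound covers\<close>
  have "(\<integral>z. lambda_fun n \<theta> z \<partial>std_gauss n) \<le> (\<integral>z. G z \<partial>std_gauss n)"
    by (rule integral_mono'[OF intG le G0])
  moreover have "2 / norm_n n (v0 n \<theta>) \<le> 2 * sqrt X"
  proof -
    have "1 / X \<le> m / X" using m X by (simp add: divide_right_mono)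
    also have "\<dots> \<le> min_energy" unfolding m_def by (rule min_energy_ge[OF chX])
    also have "\<dots> \<le> (norm_n n (v0 n \<theta>))^2" by (rule v0_norm)
    finally have "sqrt (1 / X) \<le> norm_n n (v0 n \<theta>)" by (rule real_le_lsqrt[OF norm_n_nonneg])
    moreover have "0 < sqrt (1 / X)" using X by simp
    ultimately have "2 / norm_n n (v0 n \<theta>) \<le> 2 / sqrt (1 / X)" by (intro frac_le) auto
    thus ?thesis by (simp add: real_sqrt_divide)
  qed
  ultimately show ?thesis using intle unfolding lambda_star_def m_def E_def by linarith
qed

end

theorem lemma2p9:
  fixes c1 c2 :: real
  assumes "0 < c1" "c1 \<le> 1" "1 \<le> c2"
  shows "\<exists>C>0. \<forall>n\<ge>2. \<forall>\<theta>\<in>Rn n.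
           num_jumps n \<theta> \<ge> 1 \<longrightarrow> length_condition c1 c2 n \<theta> \<longrightarrow>
           lambda_star n \<theta> \<le>
             C * sqrt (real n / real (\<Sum>i=0..num_jumps n \<theta>.
                                       if jump_sign n \<theta> i \<noteq> jump_sign n \<theta> (i + 1) then 1 else 0)
                       * ln (exp 1 * real n / (real (num_jumps n \<theta>) + 1)))"
proof -
  define r where "r = c2 / c1"
  define D where "D = 33000 * c2 * r * (1 + ln c2)"
  define C where "C = 3 * sqrt c2 + sqrt D"
  have r: "1 \<le> r" using assms unfolding r_def by simp
  have c2: "0 < c2" using assms by simp
  have D: "0 \<le> D" unfolding D_def using assms r by simp
  have C: "0 < C" unfolding C_def using c2 D by (intro add_pos_nonneg) auto
  have "lambda_star n \<theta> \<le> C * sqrt (real n / real (\<Sum>i=0..num_jumps n \<theta>.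
         if jump_sign n \<theta> i \<noteq> jump_sign n \<theta> (i + 1) then 1 else 0)
         * ln (exp 1 * real n / (real (num_jumps n \<theta>) + 1)))"
    if n: "2 \<le> n" and \<theta>: "\<theta> \<in> Rn n" and j: "1 \<le> num_jumps n \<theta>" and len: "length_condition c1 c2 n \<theta>" for n \<theta>
  proof -
    interpret signal n \<theta> by unfold_locales fact+
    define N where "N = real n / (real k + 1)"
    define X where "X = c2 * N"
    define m where "m = real (card changes)"
    define lg where "lg = ln (exp 1 * real n / (real k + 1))"
    have "k \<le> card {2..n}" unfolding num_jumps_def by (intro card_mono) (auto simp: jumps_def)
    \<comment> \<open>so that the logarithm is at least 1 and absorbs all terms of order 1\<close>
    hence kn: "real k + 1 \<le> real n" using n by simp
    have N: "1 \<le> N" unfolding N_def using kn by simp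
    have X: "1 \<le> X" unfolding X_def using mult_mono[OF assms(3) N] assms N by simp
    have m: "1 \<le> m" "m \<le> real k + 1" using card_changes unfolding m_def by linarith+
    have lg: "lg = 1 + ln N"
    proof -
      have "exp 1 * real n / (real k + 1) = exp 1 * N" by (simp add: N_def)
      thus ?thesis unfolding lg_def using N by (simp add: ln_mult)
    qed
    have lg1: "1 \<le> lg" unfolding lg using N by simp
    have sum_eq: "real (\<Sum>i=0..k. if jump_sign n \<theta> i \<noteq> jump_sign n \<theta> (i + 1) then 1 else 0) = m"
    proof -
      have "(\<Sum>i=0..k. if jump_sign n \<theta> i \<noteq> jump_sign n \<theta> (i + 1) then 1 else (0::nat)) = card (sign_changes n \<theta>)"
        unfolding sign_changes_def by (subst sum.inter_filter[symmetric]) simp_all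
      thus ?thesis unfolding m_def changes_eq by simp
    qed
    have change: "real (q (i + 1) - q i) \<le> X \<and> X \<le> r * real (q (i + 1) - q i)" if i: "i \<in> changes" for i
    proof -
      let ?L = "piece_length n \<theta>"
      have pl: "?L i = q (i + 1) - q i" using i by (intro piece_length_eq) (simp add: changes_def)
      have mem: "?L i \<in> ?L ` sign_changes n \<theta>" using i unfolding changes_eq by (rule imageI)
      have fin: "finite (?L ` sign_changes n \<theta>)" using finite_changes unfolding changes_eq by simp
      have "Min (?L ` sign_changes n \<theta>) \<le> ?L i" "?L i \<le> Max (?L ` sign_changes n \<theta>)"
        using mem fin by auto
      hence "real (Min (?L ` sign_changes n \<theta>)) \<le> real (?L i)" "real (?L i) \<le> real (Max (?L ` sign_changes n \<theta>))"
        by simp_all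
      hence *: "c1 * N \<le> real (?L i)" "real (?L i) \<le> c2 * N"
        using len unfolding length_condition_def N_def by simp_all
      have "X = r * (c1 * N)" using assms by (simp add: r_def X_def)
      also have "\<dots> \<le> r * real (?L i)" using *(1) r by (intro mult_left_mono) auto
      finally show ?thesis using *(2) unfolding pl X_def by simp
    qed
    have "lambda_star n \<theta> \<le> 3 * sqrt X + sqrt (X / m * ((real (k + 1) + 2 * real n / X) * (11000 * r * (1 + ln X))))"
      unfolding m_def by (rule lambda_star_le[OF X r change])
    also have "\<dots> \<le> 3 * (sqrt c2 * sqrt (real n / m * lg)) + sqrt D * sqrt (real n / m * lg)"
    proof (intro add_mono mult_left_mono)
      have "N \<le> real n / m" unfolding N_def using m by (intro divide_left_mono) auto
      also have "\<dots> \<le> real n / m * lg" using mult_left_mono[OF lg1, of "real n / m"] m by simp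
      finally have "c2 * N \<le> c2 * (real n / m * lg)" using c2 by (intro mult_left_mono) auto
      hence "sqrt (c2 * N) \<le> sqrt (c2 * (real n / m * lg))" by (rule real_sqrt_le_mono)
      thus "sqrt X \<le> sqrt c2 * sqrt (real n / m * lg)" unfolding X_def real_sqrt_mult .
      have "1 + ln X = ln c2 + lg" unfolding X_def lg using c2 N by (simp add: ln_mult)
      also have "\<dots> \<le> ln c2 * lg + lg" using lg1 assms(3) by (simp add: mult_le_cancel_left1)
      finally have lnX: "1 + ln X \<le> (1 + ln c2) * lg" by (simp add: distrib_right)
      have Xk: "X * (real k + 1) = c2 * real n" unfolding X_def N_def by simp
      have "X * (real (k + 1) + 2 * real n / X) = c2 * real n + 2 * real n"
        using X Xk by (simp add: distrib_left add.commute)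
      also have "\<dots> \<le> 3 * c2 * real n" using assms(3) mult_right_mono[OF assms(3), of "real n"] by simp
      finally have Xb: "X * (real (k + 1) + 2 * real n / X) \<le> 3 * c2 * real n" .
      have "X / m * ((real (k + 1) + 2 * real n / X) * (11000 * r * (1 + ln X))) = 
        (X * (real (k + 1) + 2 * real n / X)) * (11000 * r * (1 + ln X)) / m" by simp
      also have "\<dots> \<le> (3 * c2 * real n) * (11000 * r * ((1 + ln c2) * lg)) / m"
      proof (rule divide_right_mono, rule mult_mono[OF Xb mult_left_mono[OF lnX]])
        show "0 \<le> 11000 * r" "0 \<le> 3 * c2 * real n" "0 \<le> 11000 * r * (1 + ln X)" "0 \<le> m"
          using r c2 X m by auto
      qed
      also have "\<dots> = D * (real n / m * lg)" by (simp add: D_def)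
      finally show "sqrt (X / m * ((real (k + 1) + 2 * real n / X) * (11000 * r * (1 + ln X)))) \<le> sqrt D * sqrt (real n / m * lg)"
        unfolding real_sqrt_mult[symmetric] by (rule real_sqrt_le_mono)
    qed simp
    also have "\<dots> = C * sqrt (real n / m * lg)" unfolding C_def by (simp add: distrib_right)
    finally show ?thesis unfolding sum_eq lg_def .
  qed
  thus ?thesis using C by blast
qed

end
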